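(* Let $\mathbb{X}$ be a $0$-dimensional subscheme of $\mathbb{P}^n$ with $K$-rational support and homogeneous coordinate ring $R$ (setting and notation as in the context), and let $1\le i<\deg(\mathbb{X})$ and $1\le j\le r_{\mathbb{X}}-1$. Suppose that $\mathrm{char}(K)=0$ or $\mathrm{char}(K)>r_{\mathbb{X}}$. Then the scheme $\mathbb{X}$ is $(i,j)$-uniform if and only if $\mathrm{HF}_{\Omega^1_{R/K}}(j)=\mathrm{HF}_{\Omega^1_{R_{\mathbb{Y}}/K}}(j)$ for every subscheme $\mathbb{Y}\subseteq\mathbb{X}$ of degree $\deg(\mathbb{Y})=\deg(\mathbb{X})-i$.
   Context: Let $K$ be a perfect field, $n\ge 1$, $P=K[X_0,\dots,X_n]$ with the standard grading, and $\mathbb{X}\subseteq\mathbb{P}^n$ a $0$-dimensional subscheme over $K$ all of whose support points are $K$-rational, with saturated homogeneous vanishing ideal $I_{\mathbb{X}}$. Put $R=P/I_{\mathbb{X}}$ and let $x_i$ be the image of $X_i$ in $R$. Assume no point of the support of $\mathbb{X}$ lies on the hyperplane $X_0=0$; then $x_0$ is a non-zerodivisor of $R$. Let $\mathrm{HF}_{\mathbb{X}}(i)=\dim_K R_i$, $\deg(\mathbb{X})$ its constant value for $i\gg0$, and $r_{\mathbb{X}}$ the least integer with $\mathrm{HF}_{\mathbb{X}}(i)=\deg(\mathbb{X})$ for all $i\ge r_{\mathbb{X}}$. For a subscheme $\mathbb{Y}\subseteq\mathbb{X}$ with saturated vanishing ideal $I_{\mathbb{Y}}$, let $R_{\mathbb{Y}}=P/I_{\mathbb{Y}}$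 and $\mathrm{HF}_{\mathbb{Y}}(i)=\dim_K(R_{\mathbb{Y}})_i$. For $1\le i<\deg(\mathbb{X})$ and $1\le j\le r_{\mathbb{X}}-1$, the scheme $\mathbb{X}$ is called $(i,j)$-uniform if every subscheme $\mathbb{Y}\subseteq\mathbb{X}$ of degree $\deg(\mathbb{Y})=\deg(\mathbb{X})-i$ satisfies $\mathrm{HF}_{\mathbb{Y}}(j)=\mathrm{HF}_{\mathbb{X}}(j)$. Modules of Kähler differentials are graded so that differentials of the residue classes of the $X_i$ have degree $1$, and $\mathrm{HF}_M(i)=\dim_K M_i$ for a graded module $M$. *)

theory Defs
  imports
    "HOL-Library.Poly_Mapping"
    "HOL-Algebra.QuotRing"
    "Jordan_Normal_Form.VS_Connect"
begin

section \<open>Algebras over a field type, quotients, Hilbert functions\<close>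

text \<open>
  The base field is the type \<open>'k\<close>, turned into a record by \<open>class_ring\<close>.
  A \<open>'k\<close>-algebra is a record \<open>('k, 'a) module\<close>, i.e. a ring with scalar multiplication.
\<close>

definition perfect_field :: "'k::field itself \<Rightarrow> bool" where
  "perfect_field _ \<longleftrightarrow> CHAR('k) = 0 \<or> surj (\<lambda>x::'k. x ^ CHAR('k))"

text \<open>
  One record for both kinds of quotient: of an algebra by an ideal, and of a module by a
  submodule. In the latter case the fields \<open>mult\<close> and \<open>one\<close> carry no meaning
  (as for every module in HOL-Algebra).
\<close>

definition quot_module :: "('r, 'a) module \<Rightarrow> 'a set \<Rightarrow> ('r, 'a set) module" where
  "quot_module M N =
     ring.extend (M Quot N) (module.fields (\<lambda>r X. \<Union>x\<in>X. N +>\<^bsub>M\<^esub> (r \<odot>\<^bsub>M\<^esub> x)))"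

definition restrict_scalars :: "('k, 'a) module \<Rightarrow> ('a, 'b) module \<Rightarrow> ('k, 'b) module" where
  "restrict_scalars A M =
     ring.extend (ring.truncate M) (module.fields (\<lambda>c x. (c \<odot>\<^bsub>A\<^esub> \<one>\<^bsub>A\<^esub>) \<odot>\<^bsub>M\<^esub> x))"

text \<open>A grading of \<open>M\<close> is given by the family \<open>G\<close> of its homogeneous components.\<close>

definition hilbert_function ::
  "('k::field, 'b) module \<Rightarrow> (nat \<Rightarrow> 'b set) \<Rightarrow> nat \<Rightarrow> nat" where
  "hilbert_function M G i = vectorspace.dim class_ring (M\<lparr>carrier := G i\<rparr>)"


section \<open>Kaehler differentials\<close>

text \<open>
  The module of Kaehler differentials of a \<open>'k\<close>-algebra \<open>A\<close> is the free \<open>A\<close>-module on the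
  symbols \<open>ds\<close>, \<open>s \<in> A\<close>, modulo additivity, \<open>'k\<close>-linearity and the Leibniz rule.
  Elements of the free module are finitely supported functions.
\<close>

definition free_module :: "('k, 'a) module \<Rightarrow> ('a, 'a \<Rightarrow> 'a) module" where
  "free_module A =
     \<lparr>carrier = {\<phi>. (\<forall>s\<in>carrier A. \<phi> s \<in> carrier A) \<and> (\<forall>s. s \<notin> carrier A \<longrightarrow> \<phi> s = \<zero>\<^bsub>A\<^esub>) \<and>
                    finite {s. \<phi> s \<noteq> \<zero>\<^bsub>A\<^esub>}},
      mult = undefined, one = undefined,
      zero = (\<lambda>s. \<zero>\<^bsub>A\<^esub>),
      add = (\<lambda>\<phi> \<psi> s. \<phi> s \<oplus>\<^bsub>A\<^esub> \<psi> s),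
      smult = (\<lambda>r \<phi> s. r \<otimes>\<^bsub>A\<^esub> \<phi> s)\<rparr>"

definition dsym :: "('k, 'a) module \<Rightarrow> 'a \<Rightarrow> 'a \<Rightarrow> 'a" where
  "dsym A s = (\<lambda>t. if t = s then \<one>\<^bsub>A\<^esub> else \<zero>\<^bsub>A\<^esub>)"

definition kaehler_relations :: "('k, 'a) module \<Rightarrow> ('a \<Rightarrow> 'a) set" where
  "kaehler_relations A = (let F = free_module A; d = dsym A in
     {d (s \<oplus>\<^bsub>A\<^esub> t) \<ominus>\<^bsub>F\<^esub> (d s \<oplus>\<^bsub>F\<^esub> d t) | s t. s \<in> carrier A \<and> t \<in> carrier A} \<union>
     {d (c \<odot>\<^bsub>A\<^esub> s) \<ominus>\<^bsub>F\<^esub> ((c \<odot>\<^bsub>A\<^esub> \<one>\<^bsub>A\<^esub>) \<odot>\<^bsub>F\<^esub> d s) | c s. s \<in> carrier A} \<union>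
     {d (s \<otimes>\<^bsub>A\<^esub> t) \<ominus>\<^bsub>F\<^esub> (s \<odot>\<^bsub>F\<^esub> d t \<oplus>\<^bsub>F\<^esub> t \<odot>\<^bsub>F\<^esub> d s) | s t. s \<in> carrier A \<and> t \<in> carrier A})"

definition kaehler_submodule :: "('k, 'a) module \<Rightarrow> ('a \<Rightarrow> 'a) set" where
  "kaehler_submodule A = LinearCombinations.module.span A (free_module A) (kaehler_relations A)"

definition kaehler_module :: "('k, 'a) module \<Rightarrow> ('a, ('a \<Rightarrow> 'a) set) module" where
  "kaehler_module A = quot_module (free_module A) (kaehler_submodule A)"

definition kaehler_d :: "('k, 'a) module \<Rightarrow> 'a \<Rightarrow> ('a \<Rightarrow> 'a) set" where
  "kaehler_d A s = kaehler_submodule A +>\<^bsub>free_module A\<^esub> dsym A s"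

text \<open>
  If \<open>A\<close> is graded by \<open>G\<close>, then \<open>r ds\<close> is homogeneous of degree \<open>deg r + deg s\<close>;
  in particular \<open>d\<close> preserves degrees.
\<close>

definition kaehler_component ::
  "('k::field, 'a) module \<Rightarrow> (nat \<Rightarrow> 'a set) \<Rightarrow> nat \<Rightarrow> ('a \<Rightarrow> 'a) set set" where
  "kaehler_component A G i =
     LinearCombinations.module.span class_ring (restrict_scalars A (kaehler_module A))
       {r \<odot>\<^bsub>kaehler_module A\<^esub> kaehler_d A s | r s. \<exists>a b. a + b = i \<and> r \<in> G a \<and> s \<in> G b}"

definition hilbert_kaehler ::
  "('k::field, 'a) module \<Rightarrow> (nat \<Rightarrow> 'a set) \<Rightarrow> nat \<Rightarrow> nat" where
  "hilbert_kaehler A G =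
     hilbert_function (restrict_scalars A (kaehler_module A)) (kaehler_component A G)"


section \<open>The polynomial ring \<open>P = K[X\<^sub>0, \<dots>, X\<^sub>n]\<close>\<close>

type_synonym monom = "nat \<Rightarrow>\<^sub>0 nat"
type_synonym 'k polynomial = "monom \<Rightarrow>\<^sub>0 'k"

definition poly_ring :: "nat \<Rightarrow> ('k::field, 'k polynomial) module" where
  "poly_ring n =
     \<lparr>carrier = {f. \<forall>m\<in>Poly_Mapping.keys f. Poly_Mapping.keys m \<subseteq> {..n}},
      mult = (*), one = 1, zero = 0, add = (+),
      smult = (\<lambda>c f. Poly_Mapping.single 0 c * f)\<rparr>"

definition indet :: "nat \<Rightarrow> 'k::field polynomial" where
  "indet k = Poly_Mapping.single (Poly_Mapping.single k 1) 1"

definition monom_degree :: "monom \<Rightarrow> nat" where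
  "monom_degree m = (\<Sum>k\<in>Poly_Mapping.keys m. Poly_Mapping.lookup m k)"

definition forms :: "nat \<Rightarrow> nat \<Rightarrow> 'k::field polynomial set" where
  "forms n d = {f \<in> carrier (poly_ring n). \<forall>m\<in>Poly_Mapping.keys f. monom_degree m = d}"

definition hom_component :: "nat \<Rightarrow> 'k::field polynomial \<Rightarrow> 'k polynomial" where
  "hom_component d f =
     (\<Sum>m\<in>{m \<in> Poly_Mapping.keys f. monom_degree m = d}.
        Poly_Mapping.single m (Poly_Mapping.lookup f m))"

definition poly_eval :: "(nat \<Rightarrow> 'k::field) \<Rightarrow> 'k polynomial \<Rightarrow> 'k" where
  "poly_eval a f =
     (\<Sum>m\<in>Poly_Mapping.keys f.
        Poly_Mapping.lookup f m * (\<Prod>k\<in>Poly_Mapping.keys m. a k ^ Poly_Mapping.lookup m k))"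

definition homogeneous_ideal :: "nat \<Rightarrow> 'k::field polynomial set \<Rightarrow> bool" where
  "homogeneous_ideal n I \<longleftrightarrow> ideal I (poly_ring n) \<and> (\<forall>f\<in>I. \<forall>d. hom_component d f \<in> I)"

text \<open>
  Saturated means \<open>I = I : \<langle>X\<^sub>0, \<dots>, X\<^sub>n\<rangle>\<^sup>\<infinity>\<close>; the \<open>k\<close>-th power of the irrelevant ideal is
  generated by the forms of degree \<open>k\<close>.
\<close>

definition saturated :: "nat \<Rightarrow> 'k::field polynomial set \<Rightarrow> bool" where
  "saturated n I \<longleftrightarrow>
     (\<forall>f\<in>carrier (poly_ring n). (\<exists>k. \<forall>g\<in>forms n k. g * f \<in> I) \<longrightarrow> f \<in> I)"


section \<open>Closed subschemes of \<open>\<P>\<^sup>n\<close>\<close>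

text \<open>
  A closed subscheme of projective \<open>n\<close>-space over \<open>'k\<close> is represented by its saturated
  homogeneous vanishing ideal. Inclusion of subschemes is reverse inclusion of ideals.
\<close>

definition proj_subscheme :: "nat \<Rightarrow> 'k::field polynomial set \<Rightarrow> bool" where
  "proj_subscheme n I \<longleftrightarrow> homogeneous_ideal n I \<and> saturated n I"

definition subscheme_of ::
  "nat \<Rightarrow> 'k::field polynomial set \<Rightarrow> 'k polynomial set \<Rightarrow> bool" where
  "subscheme_of n J I \<longleftrightarrow> proj_subscheme n J \<and> I \<subseteq> J"

text \<open>
  The points of the scheme \<open>Proj (P/I)\<close>: homogeneous primes that contain \<open>I\<close> but not the
  irrelevant ideal.
\<close>

definition support_points :: "nat \<Rightarrow> 'k::field polynomial set \<Rightarrow> 'k polynomial set set" where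
  "support_points n I =
     {p. primeideal p (poly_ring n) \<and> homogeneous_ideal n p \<and> I \<subseteq> p \<and> \<not> indet ` {..n} \<subseteq> p}"

definition zero_dimensional :: "nat \<Rightarrow> 'k::field polynomial set \<Rightarrow> bool" where
  "zero_dimensional n I \<longleftrightarrow>
     support_points n I \<noteq> {} \<and>
     (\<forall>p\<in>support_points n I. \<forall>q\<in>support_points n I. p \<subseteq> q \<longrightarrow> p = q)"

text \<open>The vanishing ideal of the \<open>'k\<close>-rational point \<open>(a 0 : \<dots> : a n)\<close>.\<close>

definition point_ideal :: "nat \<Rightarrow> (nat \<Rightarrow> 'k::field) \<Rightarrow> 'k polynomial set" where
  "point_ideal n a = Idl\<^bsub>poly_ring n\<^esub> {f. (\<exists>d. f \<in> forms n d) \<and> poly_eval a f = 0}"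

definition rational_support :: "nat \<Rightarrow> 'k::field polynomial set \<Rightarrow> bool" where
  "rational_support n I \<longleftrightarrow>
     (\<forall>p\<in>support_points n I. \<exists>a. (\<exists>k\<le>n. a k \<noteq> 0) \<and> p = point_ideal n a)"

definition coord_ring ::
  "nat \<Rightarrow> 'k::field polynomial set \<Rightarrow> ('k, 'k polynomial set) module" where
  "coord_ring n I = quot_module (poly_ring n) I"

definition coord_component ::
  "nat \<Rightarrow> 'k::field polynomial set \<Rightarrow> nat \<Rightarrow> 'k polynomial set set" where
  "coord_component n I d = (\<lambda>f. I +>\<^bsub>poly_ring n\<^esub> f) ` forms n d"

definition HF :: "nat \<Rightarrow> 'k::field polynomial set \<Rightarrow> nat \<Rightarrow> nat" where
  "HF n I = hilbert_function (coord_ring n I) (coord_component n I)"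

definition HF_Omega :: "nat \<Rightarrow> 'k::field polynomial set \<Rightarrow> nat \<Rightarrow> nat" where
  "HF_Omega n I = hilbert_kaehler (coord_ring n I) (coord_component n I)"

text \<open>Only meaningful for (possibly empty) subschemes of dimension at most 0.\<close>

definition scheme_degree :: "nat \<Rightarrow> 'k::field polynomial set \<Rightarrow> nat" where
  "scheme_degree n I = (THE d. \<exists>i\<^sub>0. \<forall>i\<ge>i\<^sub>0. HF n I i = d)"

definition regularity_index :: "nat \<Rightarrow> 'k::field polynomial set \<Rightarrow> nat" where
  "regularity_index n I = (LEAST r. \<forall>i\<ge>r. HF n I i = scheme_degree n I)"

definition uniform_scheme :: "nat \<Rightarrow> 'k::field polynomial set \<Rightarrow> nat \<Rightarrow> nat \<Rightarrow> bool" where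
  "uniform_scheme n I i j \<longleftrightarrow>
     (\<forall>J. subscheme_of n J I \<and> scheme_degree n J = scheme_degree n I - i \<longrightarrow>
          HF n J j = HF n I j)"

end

theory Submission
  imports Defs
begin

text \<open>
  In degree \<open>j\<close> the module of differentials of \<open>P/I\<close> is the quotient of \<open>P\<^sub>j\<^sub>-\<^sub>1 dX\<^sub>0 \<oplus> \<dots> \<oplus> P\<^sub>j\<^sub>-\<^sub>1 dX\<^sub>n\<close>
  by \<open>I\<^sub>j\<^sub>-\<^sub>1 dX\<^sub>0 \<oplus> \<dots> \<oplus> I\<^sub>j\<^sub>-\<^sub>1 dX\<^sub>n + d(I\<^sub>j)\<close>. By rank-nullity, for \<open>I \<subseteq> J\<close> the two Hilbert functions of
  differentials agree at \<open>j\<close> if and only if these spaces of relations agree for \<open>I\<close> and \<open>J\<close>, and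
  the Hilbert functions of the coordinate rings agree at \<open>j\<close> if and only if \<open>I\<^sub>j = J\<^sub>j\<close>. If \<open>I\<^sub>j = J\<^sub>j\<close>,
  then \<open>I\<^sub>j\<^sub>-\<^sub>1 = J\<^sub>j\<^sub>-\<^sub>1\<close> because \<open>I\<close> is saturated, so the relations agree. Conversely, if the
  gradient of \<open>f \<in> J\<^sub>j\<close> is a relation for \<open>I\<close>, then Euler's formula gives \<open>j f \<in> I\<close>, and \<open>j\<close> is
  invertible in the base field. The equivalence thus holds for each subscheme separately.
\<close>

section \<open>Linear algebra\<close>

text \<open>The hard half of the presentation is that the listed relations are the only ones. The
  module of differentials is built from a symbol ds for every residue class s, modulo additivity,
  linearity and the Leibniz rule. That the dX_k generate it follows by induction over polynomials.
  To exclude further relations, a map is needed from the free module on all the ds back to tuples of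
  polynomials; it lifts each residue class to a polynomial and takes its gradient. No lift
  compatible with the ring structure is available, so every property of this map is stated as a
  congruence modulo gradients of elements of I and tuples with entries in I. Both quotients, for I
  and for J, are images of the same finite-dimensional space of tuples of forms. Comparing kernels
  inside this space makes it unnecessary to construct the map between the two modules of
  differentials or to compute any dimension.\<close>

lemma (in vectorspace) subspace_finite_basis:
  assumes "fin_dim" and U: "VectorSpace.subspace K U V"
  obtains B where "finite B" "vectorspace.basis K (vs U) B"
proof -
  interpret U: vectorspace K "vs U" using U by (rule subspace_is_vs)
  have UV: "U \<subseteq> carrier V" using U is_module submodule.subset by blast
  \<comment> \<open>Independence in U is independence in V, so the dimension of V bounds the
    independent subsets of U. With this bound a maximal one exists, and it is a basis.\<close>
  have small: "finite A \<and> card A \<le> dim" if "A \<subseteq> U" "U.lin_indpt A" for A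
    using span_li_not_depend(2)[of A U] li_le_dim[OF assms(1), of A] is_module[OF U] that UV by auto
  have "\<exists>A. finite A \<and> maximal A (\<lambda>S. S \<subseteq> carrier (vs U) \<and> U.lin_indpt S)"
    by (rule maximal_exists[where ?N = dim and ?B = "{}"]) (use small in \<open>auto simp: U.lin_dep_def\<close>)
  then show thesis
    using that U.max_li_is_basis by blast
qed

text \<open>A basis of U stays independent in W and has as many elements as the dimension of W, so
  it is a basis of W too; both spaces are its span.\<close>

lemma (in vectorspace) subspace_eqI_dim:
  assumes "fin_dim" and U: "VectorSpace.subspace K U V" and W: "VectorSpace.subspace K W V"
    and "U \<subseteq> W" and dim: "vectorspace.dim K (vs U) = vectorspace.dim K (vs W)"
  shows "U = W"
proof -
  interpret U: vectorspace K "vs U" using U by (rule subspace_is_vs)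
  interpret W: vectorspace K "vs W" using W by (rule subspace_is_vs)
  obtain B where B: "finite B" "U.basis B" using subspace_finite_basis[OF assms(1) U] .
  obtain C where C: "finite C" "W.basis C" using subspace_finite_basis[OF assms(1) W] .
  have BU: "B \<subseteq> U" "U.lin_indpt B" "U.span B = U" using B(2) by (auto simp: U.basis_def)
  have "W.fin_dim" using C by (auto simp: W.fin_dim_def W.basis_def)
  moreover have "W.lin_indpt B"
    using span_li_not_depend(2)[OF BU(1) is_module[OF U]]
      span_li_not_depend(2)[of B W] is_module[OF W] BU \<open>U \<subseteq> W\<close> by auto
  ultimately have "W.basis B"
    using W.dim_li_is_basis[of B] B(1) BU(1) \<open>U \<subseteq> W\<close> dim U.dim_basis[OF B] by auto
  then have "W.span B = W" by (simp add: W.basis_def)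
  then show ?thesis
    using span_li_not_depend(1)[OF BU(1) is_module[OF U]]
      span_li_not_depend(1)[of B W] is_module[OF W] BU \<open>U \<subseteq> W\<close> by auto
qed

text \<open>By rank-nullity the images have equal dimension exactly if the kernels do, and nested
  kernels of equal finite dimension coincide. Only the common source V has to be finite-dimensional;
  the targets will be whole coordinate rings and modules of differentials.\<close>

lemma dim_image_eq_iff_kernel_eq:
  assumes V: "vectorspace K V" and fd: "vectorspace.fin_dim K V"
    and M: "module K M" and f: "f \<in> LinearCombinations.module_hom K V M"
    and N: "module K N" and g: "g \<in> LinearCombinations.module_hom K V N"
    and le: "{v \<in> carrier V. f v = \<zero>\<^bsub>M\<^esub>} \<subseteq> {v \<in> carrier V. g v = \<zero>\<^bsub>N\<^esub>}"
  shows "vectorspace.dim K (M\<lparr>carrier := f ` carrier V\<rparr>) = vectorspace.dim K (N\<lparr>carrier := g ` carrier V\<rparr>)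
    \<longleftrightarrow> {v \<in> carrier V. f v = \<zero>\<^bsub>M\<^esub>} = {v \<in> carrier V. g v = \<zero>\<^bsub>N\<^esub>}"
proof -
  interpret V: vectorspace K V by fact
  interpret M: vectorspace K M using M V.field_axioms by (simp add: vectorspace_def)
  interpret N: vectorspace K N using N V.field_axioms by (simp add: vectorspace_def)
  interpret f: linear_map K V M f by unfold_locales (rule f)
  interpret g: linear_map K V N g by unfold_locales (rule g)
  have eq: "f.kerT = g.kerT" if "vectorspace.dim K (V.vs f.kerT) = vectorspace.dim K (V.vs g.kerT)"
    using V.subspace_eqI_dim[OF fd f.kerT_is_subspace g.kerT_is_subspace _ that] le
    by (simp add: f.ker_def g.ker_def)
  have "vectorspace.dim K (M.vs f.imT) = vectorspace.dim K (N.vs g.imT) \<longleftrightarrow>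
      vectorspace.dim K (V.vs f.kerT) = vectorspace.dim K (V.vs g.kerT)"
    using f.rank_nullity[OF fd] g.rank_nullity[OF fd] by linarith
  also have "\<dots> \<longleftrightarrow> f.kerT = g.kerT"
    using eq by auto
  finally show ?thesis
    by (simp add: f.ker_def g.ker_def f.im_def g.im_def)
qed

section \<open>Monomials\<close>

lemma poly_mapping_sum_singles:
  "f = (\<Sum>m\<in>Poly_Mapping.keys f. Poly_Mapping.single m (Poly_Mapping.lookup f m))"
  by (rule poly_mapping_eqI)
    (simp add: lookup_sum lookup_single when_def sum.delta in_keys_iff)

lemma monom_degree_add: "monom_degree (m + m') = monom_degree m + monom_degree m'"
  unfolding monom_degree_def by (rule setsum_keys_plus_distrib) auto

lemma monom_degree_single [simp]: "monom_degree (Poly_Mapping.single k e) = e"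
  by (cases "e = 0") (auto simp: monom_degree_def)

lemma monom_degree_zero [simp]: "monom_degree 0 = 0"
  by (simp add: monom_degree_def)

lemma monom_split:
  assumes "Poly_Mapping.lookup m k \<noteq> 0"
  shows "m = (m - Poly_Mapping.single k 1) + Poly_Mapping.single k (1::nat)"
  using assms by (intro poly_mapping_eqI) (auto simp: lookup_add lookup_minus lookup_single when_def)

lemma keys_add_monom: "Poly_Mapping.keys (m + m' :: monom) = Poly_Mapping.keys m \<union> Poly_Mapping.keys m'"
  by (auto simp: in_keys_iff lookup_add)

lemma keys_minus_monom: "Poly_Mapping.keys (m - m' :: monom) \<subseteq> Poly_Mapping.keys m"
  by (auto simp: in_keys_iff lookup_minus)

text \<open>A monomial is determined by its exponents, and each of them is at most the
  degree.\<close>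

lemma finite_monoms: "finite {m. Poly_Mapping.keys m \<subseteq> {..n} \<and> monom_degree m = d}"
proof (rule finite_imageD)
  let ?M = "{m. Poly_Mapping.keys m \<subseteq> {..n} \<and> monom_degree m = d}"
  show "finite (Poly_Mapping.lookup ` ?M)"
  proof (rule finite_subset)
    show "Poly_Mapping.lookup ` ?M \<subseteq> {h. \<forall>k. (k \<in> {..n} \<longrightarrow> h k \<in> {..d}) \<and> (k \<notin> {..n} \<longrightarrow> h k = 0)}"
    proof clarsimp
      fix m :: monom and k assume m: "Poly_Mapping.keys m \<subseteq> {..n}"
      have "Poly_Mapping.lookup m k \<le> monom_degree m"
        unfolding monom_degree_def
        by (cases "k \<in> Poly_Mapping.keys m") (auto intro: member_le_sum simp: in_keys_iff)
      then show "(k \<le> n \<longrightarrow> Poly_Mapping.lookup m k \<le> monom_degree m) \<and>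
         (\<not> k \<le> n \<longrightarrow> Poly_Mapping.lookup m k = 0)"
        using m by (auto simp: subset_iff in_keys_iff)
    qed
  qed (intro finite_set_of_finite_funs finite_atMost)
  show "inj_on Poly_Mapping.lookup ?M" by (rule inj_onI) (simp only: poly_mapping_eq_iff)
qed

section \<open>Polynomials and forms\<close>

lemma poly_ring_simps [simp]:
  "mult (poly_ring n) = (*)" "one (poly_ring n) = 1" "zero (poly_ring n) = 0"
  "add (poly_ring n) = (+)" "smult (poly_ring n) = (\<lambda>c f. Poly_Mapping.single 0 c * f)"
  by (simp_all add: poly_ring_def)

lemma carrier_poly_ring:
  "f \<in> carrier (poly_ring n) \<longleftrightarrow> (\<forall>m\<in>Poly_Mapping.keys f. Poly_Mapping.keys m \<subseteq> {..n})"
  by (simp add: poly_ring_def)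

lemma poly_ring_uminus: "f \<in> carrier (poly_ring n) \<Longrightarrow> - f \<in> carrier (poly_ring n)"
  by (simp add: carrier_poly_ring in_keys_iff)

lemma poly_ring_closed:
  assumes "f \<in> carrier (poly_ring n)" "g \<in> carrier (poly_ring n)"
  shows "f + g \<in> carrier (poly_ring n)" "f * g \<in> carrier (poly_ring n)" "f - g \<in> carrier (poly_ring n)"
proof -
  have add: "f + g \<in> carrier (poly_ring n)"
    if "f \<in> carrier (poly_ring n)" "g \<in> carrier (poly_ring n)" for f g :: "'a polynomial"
    using that keys_add[of f g] by (fastforce simp: carrier_poly_ring)
  show "f + g \<in> carrier (poly_ring n)"
    using assms by (rule add)
  show "f * g \<in> carrier (poly_ring n)"
    using assms keys_mult[of f g] by (fastforce simp: carrier_poly_ring keys_add_monom)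
  show "f - g \<in> carrier (poly_ring n)"
    using add[OF assms(1) poly_ring_uminus[OF assms(2)]] by simp
qed

lemma poly_ring_consts [simp]:
  "0 \<in> carrier (poly_ring n)" "1 \<in> carrier (poly_ring n)" "Poly_Mapping.single 0 c \<in> carrier (poly_ring n)"
  by (auto simp: carrier_poly_ring)

lemma poly_ring_algebra: "algebra class_ring (poly_ring n :: ('k::field, 'k polynomial) module)"
proof (rule algebraI)
  have "abelian_group (poly_ring n :: ('k, 'k polynomial) module)"
  proof (rule abelian_groupI)
    show "\<exists>y\<in>carrier (poly_ring n). y \<oplus>\<^bsub>poly_ring n\<^esub> x = \<zero>\<^bsub>poly_ring n\<^esub>"
      if "x \<in> carrier (poly_ring n)" for x :: "'k polynomial"
      using that by (intro bexI[of _ "- x"]) (simp_all add: poly_ring_uminus)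
  qed (simp_all add: poly_ring_closed add_ac)
  moreover have "comm_monoid (poly_ring n :: ('k, 'k polynomial) module)"
    by (rule comm_monoidI) (simp_all add: poly_ring_closed mult_ac)
  ultimately show "cring (poly_ring n :: ('k, 'k polynomial) module)"
    by (rule cringI) (simp add: distrib_right)
  fix a b :: 'k and x :: "'k polynomial"
  have "Poly_Mapping.single 0 (a * b) = Poly_Mapping.single 0 a * (Poly_Mapping.single 0 b :: 'k polynomial)"
    by (simp add: mult_single)
  then show "(a \<otimes>\<^bsub>class_ring\<^esub> b) \<odot>\<^bsub>poly_ring n\<^esub> x = a \<odot>\<^bsub>poly_ring n\<^esub> (b \<odot>\<^bsub>poly_ring n\<^esub> x)"
    by (simp add: mult.assoc)
qed (simp_all add: poly_ring_closed single_add distrib_left distrib_right mult.assoc class_cring.cring_axioms)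

text \<open>The constants and the X_k generate P as a ring. Monomials are reached by splitting off
  one variable at a time. The rule serves to compare two derivations, which then only have to agree
  on generators.\<close>

lemma poly_ring_induct [consumes 1, case_names const indet add mult]:
  assumes "f \<in> carrier (poly_ring n)"
    and const: "\<And>c. P (Poly_Mapping.single 0 c)"
    and indet: "\<And>k. k \<le> n \<Longrightarrow> P (indet k)"
    and add: "\<And>f g. f \<in> carrier (poly_ring n) \<Longrightarrow> g \<in> carrier (poly_ring n) \<Longrightarrow> P f \<Longrightarrow> P g \<Longrightarrow> P (f + g)"
    and mult: "\<And>f g. f \<in> carrier (poly_ring n) \<Longrightarrow> g \<in> carrier (poly_ring n) \<Longrightarrow> P f \<Longrightarrow> P g \<Longrightarrow> P (f * g)"
  shows "P f"
proof -
  have monom: "P (Poly_Mapping.single m 1)" if "Poly_Mapping.keys m \<subseteq> {..n}" for m :: monom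
    using that
  proof (induction "monom_degree m" arbitrary: m rule: less_induct)
    case less
    show ?case
    proof (cases "m = 0")
      case True
      then show ?thesis using const[of 1] by simp
    next
      case False
      then obtain k where k: "Poly_Mapping.lookup m k \<noteq> 0"
        by (metis lookup_zero poly_mapping_eqI)
      define m' where "m' = m - Poly_Mapping.single k (1::nat)"
      have m: "m = m' + Poly_Mapping.single k 1"
        using monom_split[OF k] by (simp add: m'_def)
      have "Poly_Mapping.keys m' \<subseteq> {..n}" "k \<le> n"
        using less.prems k keys_minus_monom[of m] by (auto simp: m'_def in_keys_iff subset_iff)
      moreover have "monom_degree m' < monom_degree m"
        by (subst m) (simp add: monom_degree_add)
      ultimately have "P (Poly_Mapping.single m' 1)" "P (indet k)"
        using less.hyps indet by auto
      moreover have "Poly_Mapping.single m 1 = Poly_Mapping.single m' 1 * (indet k :: 'a polynomial)"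
        by (subst m) (simp add: indet_def mult_single)
      moreover have "Poly_Mapping.single m' 1 \<in> carrier (poly_ring n)" "indet k \<in> carrier (poly_ring n)"
        using \<open>Poly_Mapping.keys m' \<subseteq> {..n}\<close> \<open>k \<le> n\<close> by (auto simp: carrier_poly_ring indet_def)
      ultimately show ?thesis using mult by metis
    qed
  qed
  have term_in: "Poly_Mapping.single m c \<in> carrier (poly_ring n)"
    if "Poly_Mapping.keys m \<subseteq> {..n}" for m :: monom and c :: 'a
    using that by (auto simp: carrier_poly_ring)
  have term_P: "P (Poly_Mapping.single m c)" if "Poly_Mapping.keys m \<subseteq> {..n}" for m c
    using mult[of "Poly_Mapping.single 0 c" "Poly_Mapping.single m 1"] term_in[OF that] const monom[OF that]
    by (simp add: mult_single)
  \<comment> \<open>Membership in the ring is carried through the induction because the premise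
    \<open>add\<close> asks for it.\<close>
  have "(\<Sum>m\<in>A. Poly_Mapping.single m (Poly_Mapping.lookup f m)) \<in> carrier (poly_ring n) \<and>
      P (\<Sum>m\<in>A. Poly_Mapping.single m (Poly_Mapping.lookup f m))"
    if "finite A" "A \<subseteq> Poly_Mapping.keys f" for A
    using that
  proof (induction A rule: finite_induct)
    case empty
    then show ?case using const[of 0] by simp
  next
    case (insert m A)
    then have "Poly_Mapping.keys m \<subseteq> {..n}"
      using assms(1) by (auto simp: carrier_poly_ring)
    with insert show ?case
      using add term_in term_P by (simp add: poly_ring_closed)
  qed
  from this[of "Poly_Mapping.keys f"] show ?thesis
    by (simp flip: poly_mapping_sum_singles)
qed

section \<open>Partial derivatives\<close>

text \<open>If X_k does not occur in m, the truncated subtraction leaves m unchanged, but the factor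
  \<open>of_nat (Poly_Mapping.lookup m k)\<close> is then 0.\<close>

definition partial_deriv :: "nat \<Rightarrow> 'k::field polynomial \<Rightarrow> 'k polynomial" where
  "partial_deriv k f = (\<Sum>m\<in>Poly_Mapping.keys f.
     Poly_Mapping.single (m - Poly_Mapping.single k 1) (of_nat (Poly_Mapping.lookup m k) * Poly_Mapping.lookup f m))"

text \<open>Only the monomial m X_k contributes to the coefficient at m. With this formula linearity
  and the behaviour on degrees can be read off coefficientwise.\<close>

lemma lookup_partial_deriv:
  "Poly_Mapping.lookup (partial_deriv k f) m =
     of_nat (Suc (Poly_Mapping.lookup m k)) * Poly_Mapping.lookup f (m + Poly_Mapping.single k 1)"
proof -
  let ?e = "Poly_Mapping.single k (1::nat)"
  \<comment> \<open>The condition on m' is solved for m', so that the sum below collapses to a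
    single term. A monomial without X_k satisfies the left condition possibly, but with coefficient
    0.\<close>
  have *: "(of_nat (Poly_Mapping.lookup m' k) * Poly_Mapping.lookup f m' when m' - ?e = m) =
      (of_nat (Suc (Poly_Mapping.lookup m k)) * Poly_Mapping.lookup f (m + ?e) when m + ?e = m')" for m'
  proof (cases "Poly_Mapping.lookup m' k = 0")
    case True
    then have "m + ?e \<noteq> m'" by (auto simp: lookup_add)
    with True show ?thesis by simp
  next
    case False
    then show ?thesis using monom_split[OF False] by (auto simp: when_def lookup_add lookup_minus)
  qed
  have "Poly_Mapping.lookup (partial_deriv k f) m =
      (\<Sum>m'\<in>Poly_Mapping.keys f. of_nat (Poly_Mapping.lookup m' k) * Poly_Mapping.lookup f m' when m' - ?e = m)"
    by (simp add: partial_deriv_def lookup_sum lookup_single)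
  also have "\<dots> = of_nat (Suc (Poly_Mapping.lookup m k)) * Poly_Mapping.lookup f (m + ?e)"
    unfolding * by (auto simp: when_def sum.delta in_keys_iff)
  finally show ?thesis .
qed

lemma partial_deriv_add: "partial_deriv k (f + g) = partial_deriv k f + partial_deriv k g"
  by (rule poly_mapping_eqI) (simp add: lookup_partial_deriv lookup_add algebra_simps)

lemma partial_deriv_diff: "partial_deriv k (f - g) = partial_deriv k f - partial_deriv k g"
  by (rule poly_mapping_eqI) (simp add: lookup_partial_deriv lookup_minus algebra_simps)

lemma partial_deriv_0 [simp]: "partial_deriv k 0 = 0"
  by (simp add: partial_deriv_def)

lemma partial_deriv_single:
  "partial_deriv k (Poly_Mapping.single m c) =
     Poly_Mapping.single (m - Poly_Mapping.single k 1) (of_nat (Poly_Mapping.lookup m k) * c)"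
  by (cases "c = 0") (simp_all add: partial_deriv_def)

lemma partial_deriv_const [simp]: "partial_deriv k (Poly_Mapping.single 0 c) = 0"
  by (simp add: partial_deriv_single)

lemma partial_deriv_indet: "partial_deriv k (indet l) = (if k = l then 1 else 0)"
  by (simp add: indet_def partial_deriv_single lookup_single)

lemma partial_deriv_sum: "partial_deriv k (sum h A) = (\<Sum>a\<in>A. partial_deriv k (h a))"
  by (induction A rule: infinite_finite_induct) (auto simp: partial_deriv_add)

lemma partial_deriv_mult_single:
  "partial_deriv k (Poly_Mapping.single m a * Poly_Mapping.single m' b) =
     Poly_Mapping.single m a * partial_deriv k (Poly_Mapping.single m' b) +
     Poly_Mapping.single m' b * partial_deriv k (Poly_Mapping.single m a)"
proof -
  let ?e = "Poly_Mapping.single k (1::nat)"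
  have shift: "m + (m' - ?e) = m + m' - ?e" if "Poly_Mapping.lookup m' k \<noteq> 0" for m m' :: monom
    using that by (intro poly_mapping_eqI) (auto simp: lookup_add lookup_minus lookup_single when_def)
  \<comment> \<open>The exponents may differ when X_k is absent from m', but then both coefficients
    vanish.\<close>
  have "Poly_Mapping.single (m + (m' - ?e)) (of_nat (Poly_Mapping.lookup m' k) * c) =
      Poly_Mapping.single (m + m' - ?e) (of_nat (Poly_Mapping.lookup m' k) * c)" for m m' :: monom and c :: 'a
    using shift[of m' m] by (cases "Poly_Mapping.lookup m' k = 0") (simp, simp only: not_False_eq_True)
  from this[of m m' "a * b"] this[of m' m "a * b"] show ?thesis
    by (simp add: partial_deriv_single mult_single lookup_add single_add algebra_simps)
qed

text \<open>Both sides are bilinear in f and g, so the rule for two terms is summed over all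
  pairs.\<close>

lemma partial_deriv_mult:
  "partial_deriv k (f * g) = f * partial_deriv k g + g * partial_deriv k f"
proof -
  let ?F = "\<lambda>m. Poly_Mapping.single m (Poly_Mapping.lookup f m)"
  let ?G = "\<lambda>m. Poly_Mapping.single m (Poly_Mapping.lookup g m)"
  let ?A = "Poly_Mapping.keys f" and ?B = "Poly_Mapping.keys g"
  have "partial_deriv k ((\<Sum>m\<in>?A. ?F m) * (\<Sum>m'\<in>?B. ?G m')) =
      (\<Sum>m\<in>?A. \<Sum>m'\<in>?B. ?F m * partial_deriv k (?G m') + ?G m' * partial_deriv k (?F m))"
    by (simp only: sum_product partial_deriv_sum partial_deriv_mult_single)
  also have "\<dots> = (\<Sum>m\<in>?A. ?F m) * partial_deriv k (\<Sum>m'\<in>?B. ?G m') +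
      (\<Sum>m'\<in>?B. ?G m') * partial_deriv k (\<Sum>m\<in>?A. ?F m)"
    by (simp add: sum_product partial_deriv_sum sum.distrib sum.swap[of _ ?A ?B])
  finally show ?thesis
    by (simp flip: poly_mapping_sum_singles)
qed

lemma partial_deriv_closed:
  assumes "f \<in> carrier (poly_ring n)"
  shows "partial_deriv k f \<in> carrier (poly_ring n)"
  unfolding carrier_poly_ring
proof
  fix m assume "m \<in> Poly_Mapping.keys (partial_deriv k f)"
  then have "m + Poly_Mapping.single k 1 \<in> Poly_Mapping.keys f"
    unfolding in_keys_iff lookup_partial_deriv by auto
  then show "Poly_Mapping.keys m \<subseteq> {..n}"
    using assms unfolding carrier_poly_ring keys_add_monom[symmetric] by (metis Un_subset_iff keys_add_monom)
qed

section \<open>Homogeneous components\<close>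

lemma lookup_hom_component:
  "Poly_Mapping.lookup (hom_component d f) m = (if monom_degree m = d then Poly_Mapping.lookup f m else 0)"
  by (simp add: hom_component_def lookup_sum lookup_single when_def sum.delta in_keys_iff)

lemma hom_component_diff: "hom_component d (f - g) = hom_component d f - hom_component d g"
  by (rule poly_mapping_eqI) (simp add: lookup_hom_component lookup_minus)

lemma hom_component_partial_deriv:
  "hom_component d (partial_deriv k f) = partial_deriv k (hom_component (Suc d) f)"
  by (rule poly_mapping_eqI)
    (simp add: lookup_hom_component lookup_partial_deriv monom_degree_add)

lemma hom_component_form: "f \<in> forms n d \<Longrightarrow> hom_component d f = f"
  by (rule poly_mapping_eqI) (auto simp: lookup_hom_component forms_def in_keys_iff)

lemma hom_component_in_forms:
  "f \<in> carrier (poly_ring n) \<Longrightarrow> hom_component d f \<in> forms n d"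
  by (auto simp: forms_def carrier_poly_ring in_keys_iff lookup_hom_component split: if_splits)

lemma forms_subset: "f \<in> forms n d \<Longrightarrow> f \<in> carrier (poly_ring n)"
  by (simp add: forms_def)

lemma forms_zero [simp]: "0 \<in> forms n d"
  by (simp add: forms_def)

lemma forms_add: "f \<in> forms n d \<Longrightarrow> g \<in> forms n d \<Longrightarrow> f + g \<in> forms n d"
  using keys_add[of f g] by (auto simp: forms_def poly_ring_closed)

lemma forms_uminus: "f \<in> forms n d \<Longrightarrow> - f \<in> forms n d"
  by (auto simp: forms_def poly_ring_uminus in_keys_iff)

lemma forms_diff: "f \<in> forms n d \<Longrightarrow> g \<in> forms n d \<Longrightarrow> f - g \<in> forms n d"
  using forms_add[OF _ forms_uminus, of f n d g] by simp

lemma forms_mult: "f \<in> forms n d \<Longrightarrow> g \<in> forms n e \<Longrightarrow> f * g \<in> forms n (d + e)"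
  using keys_mult[of f g] by (fastforce simp: forms_def poly_ring_closed monom_degree_add)

lemma forms_const [simp]: "Poly_Mapping.single 0 c \<in> forms n 0"
  by (simp add: forms_def)

lemma forms_smult: "f \<in> forms n d \<Longrightarrow> Poly_Mapping.single 0 c * f \<in> forms n d"
  using forms_mult[OF forms_const, of f n d c] by simp

lemma indet_in_forms: "k \<le> n \<Longrightarrow> indet k \<in> forms n 1"
  by (simp add: forms_def indet_def carrier_poly_ring)

lemma partial_deriv_in_forms:
  assumes "f \<in> forms n (Suc d)" shows "partial_deriv k f \<in> forms n d"
proof -
  have "partial_deriv k f = hom_component d (partial_deriv k f)"
    using assms by (simp add: hom_component_partial_deriv hom_component_form)
  then show ?thesis
    using hom_component_in_forms partial_deriv_closed forms_subset assms by metis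
qed

text \<open>Covers the one degree that \<open>partial_deriv_in_forms\<close> leaves out, where
  differentiation cannot lower the degree.\<close>

lemma partial_deriv_forms_0:
  assumes "f \<in> forms n 0" shows "partial_deriv k f = 0"
proof (rule poly_mapping_eqI)
  fix m
  have "m + Poly_Mapping.single k 1 \<notin> Poly_Mapping.keys f"
    using assms by (auto simp: forms_def monom_degree_add dest!: bspec)
  then show "Poly_Mapping.lookup (partial_deriv k f) m = Poly_Mapping.lookup 0 m"
    unfolding lookup_partial_deriv in_keys_iff by simp
qed

text \<open>The operator f \<mapsto> X_k (df/dX_k) multiplies a monomial by its exponent at X_k, and
  the exponents add up to the degree.\<close>

lemma euler_formula:
  assumes "f \<in> forms n d"
  shows "(\<Sum>k\<le>n. indet k * partial_deriv k f) = of_nat d * f"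
proof -
  have single: "(\<Sum>k\<le>n. indet k * partial_deriv k (Poly_Mapping.single m c)) =
      of_nat (monom_degree m) * Poly_Mapping.single m c"
    if "Poly_Mapping.keys m \<subseteq> {..n}" for m and c :: 'a
  proof -
    have "indet k * partial_deriv k (Poly_Mapping.single m c) =
        of_nat (Poly_Mapping.lookup m k) * Poly_Mapping.single m c" for k
    proof (cases "Poly_Mapping.lookup m k = 0")
      case False
      from monom_split[OF this] have "Poly_Mapping.single k 1 + (m - Poly_Mapping.single k 1) = m"
        by (simp only: add.commute)
      then show ?thesis
        unfolding partial_deriv_single indet_def mult_single single_of_nat[symmetric] by simp
    qed (simp add: partial_deriv_single)
    then have "(\<Sum>k\<le>n. indet k * partial_deriv k (Poly_Mapping.single m c)) =
        of_nat (\<Sum>k\<le>n. Poly_Mapping.lookup m k) * Poly_Mapping.single m c"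
      by (simp add: sum_distrib_right)
    also have "(\<Sum>k\<le>n. Poly_Mapping.lookup m k) = monom_degree m"
      unfolding monom_degree_def using that by (intro sum.mono_neutral_right) (auto simp: in_keys_iff)
    finally show ?thesis by simp
  qed
  let ?F = "\<lambda>m. Poly_Mapping.single m (Poly_Mapping.lookup f m)" and ?A = "Poly_Mapping.keys f"
  have "(\<Sum>k\<le>n. indet k * partial_deriv k (\<Sum>m\<in>?A. ?F m)) =
      (\<Sum>m\<in>?A. \<Sum>k\<le>n. indet k * partial_deriv k (?F m))"
    by (simp add: partial_deriv_sum sum_distrib_left sum.swap[of _ ?A])
  also have "\<dots> = of_nat d * (\<Sum>m\<in>?A. ?F m)"
    unfolding sum_distrib_left
    by (rule sum.cong) (use assms in \<open>auto simp: single forms_def carrier_poly_ring\<close>)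
  finally show ?thesis
    by (simp flip: poly_mapping_sum_singles)
qed

section \<open>Quotients and restriction of scalars\<close>

lemma quot_module_simps [simp]:
  "carrier (quot_module M N) = a_rcosets\<^bsub>M\<^esub> N"
  "mult (quot_module M N) = rcoset_mult M N"
  "one (quot_module M N) = N +>\<^bsub>M\<^esub> \<one>\<^bsub>M\<^esub>"
  "zero (quot_module M N) = N"
  "add (quot_module M N) = set_add M"
  by (simp_all add: quot_module_def ring.defs module.defs FactRing_def)

lemma smult_quot_module:
  "r \<odot>\<^bsub>quot_module M N\<^esub> X = (\<Union>x\<in>X. N +>\<^bsub>M\<^esub> (r \<odot>\<^bsub>M\<^esub> x))"
  by (simp add: quot_module_def ring.defs module.defs)

lemma restrict_scalars_simps [simp]:
  "carrier (restrict_scalars A M) = carrier M"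
  "zero (restrict_scalars A M) = zero M"
  "add (restrict_scalars A M) = add M"
  "smult (restrict_scalars A M) = (\<lambda>c x. (c \<odot>\<^bsub>A\<^esub> \<one>\<^bsub>A\<^esub>) \<odot>\<^bsub>M\<^esub> x)"
  by (simp_all add: restrict_scalars_def ring.defs module.defs)

text \<open>Each axiom for W is lifted to elements of V and pushed down again. This yields the
  module axioms of a quotient from the compatibility of the coset map with the operations.\<close>

lemma module_image:
  fixes V (structure) and W (structure)
  assumes "module R V" and im: "f ` carrier V = carrier W"
    and zero: "f \<zero>\<^bsub>V\<^esub> = \<zero>\<^bsub>W\<^esub>"
    and add: "\<And>x y. x \<in> carrier V \<Longrightarrow> y \<in> carrier V \<Longrightarrow> f (x \<oplus>\<^bsub>V\<^esub> y) = f x \<oplus>\<^bsub>W\<^esub> f y"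
    and smult: "\<And>a x. a \<in> carrier R \<Longrightarrow> x \<in> carrier V \<Longrightarrow> f (a \<odot>\<^bsub>V\<^esub> x) = a \<odot>\<^bsub>W\<^esub> f x"
  shows "module R W"
proof -
  interpret V: Module.module R V by fact
  have rep: "\<exists>x'\<in>carrier V. x = f x'" if "x \<in> carrier W" for x
    using that unfolding im[symmetric] by auto
  have closed: "f x \<in> carrier W" if "x \<in> carrier V" for x
    using that unfolding im[symmetric] by (rule imageI)
  show ?thesis
  proof (rule moduleI)
    show "abelian_group W"
    proof (rule abelian_groupI)
      fix x y z assume "x \<in> carrier W" "y \<in> carrier W" "z \<in> carrier W"
      with rep obtain x' y' z' where *: "x' \<in> carrier V" "y' \<in> carrier V" "z' \<in> carrier V"
        "x = f x'" "y = f y'" "z = f z'" by metis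
      then show "x \<oplus>\<^bsub>W\<^esub> y \<oplus>\<^bsub>W\<^esub> z = x \<oplus>\<^bsub>W\<^esub> (y \<oplus>\<^bsub>W\<^esub> z)"
        by (simp flip: add add: V.M.a_assoc)
    next
      fix x y assume "x \<in> carrier W" "y \<in> carrier W"
      with rep obtain x' y' where *: "x' \<in> carrier V" "y' \<in> carrier V" "x = f x'" "y = f y'" by blast
      then show "x \<oplus>\<^bsub>W\<^esub> y = y \<oplus>\<^bsub>W\<^esub> x" "x \<oplus>\<^bsub>W\<^esub> y \<in> carrier W"
        by (simp_all flip: add add: V.M.a_comm closed)
    next
      fix x assume "x \<in> carrier W"
      with rep obtain x' where *: "x' \<in> carrier V" "x = f x'" by blast
      then show "\<zero>\<^bsub>W\<^esub> \<oplus>\<^bsub>W\<^esub> x = x" by (simp flip: add zero)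
      from * have "f (\<ominus>\<^bsub>V\<^esub> x') \<oplus>\<^bsub>W\<^esub> x = \<zero>\<^bsub>W\<^esub>"
        by (simp flip: add zero add: V.M.l_neg)
      then show "\<exists>y\<in>carrier W. y \<oplus>\<^bsub>W\<^esub> x = \<zero>\<^bsub>W\<^esub>"
        using closed * by blast
    qed (use closed[OF V.M.zero_closed] zero in simp)
  next
    fix a b x y assume ab: "a \<in> carrier R" "b \<in> carrier R" and "x \<in> carrier W" "y \<in> carrier W"
    with rep obtain x' y' where "x' \<in> carrier V" "y' \<in> carrier V" "x = f x'" "y = f y'" by blast
    with ab show "a \<odot>\<^bsub>W\<^esub> (x \<oplus>\<^bsub>W\<^esub> y) = a \<odot>\<^bsub>W\<^esub> x \<oplus>\<^bsub>W\<^esub> a \<odot>\<^bsub>W\<^esub> y"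
      by (simp flip: add smult add: V.smult_r_distr)
  next
    fix a b x assume ab: "a \<in> carrier R" "b \<in> carrier R" and "x \<in> carrier W"
    with rep obtain x' where "x' \<in> carrier V" "x = f x'" by blast
    with ab show "a \<odot>\<^bsub>W\<^esub> x \<in> carrier W" "(a \<oplus>\<^bsub>R\<^esub> b) \<odot>\<^bsub>W\<^esub> x = a \<odot>\<^bsub>W\<^esub> x \<oplus>\<^bsub>W\<^esub> b \<odot>\<^bsub>W\<^esub> x"
      "(a \<otimes>\<^bsub>R\<^esub> b) \<odot>\<^bsub>W\<^esub> x = a \<odot>\<^bsub>W\<^esub> (b \<odot>\<^bsub>W\<^esub> x)"
      by (simp_all flip: add smult add: V.smult_l_distr V.smult_assoc1 closed)
  next
    fix x assume "x \<in> carrier W"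
    with rep obtain x' where "x' \<in> carrier V" "x = f x'" by blast
    then show "\<one>\<^bsub>R\<^esub> \<odot>\<^bsub>W\<^esub> x = x"
      by (simp flip: smult)
  qed (rule V.R.cring_axioms)
qed

text \<open>Negatives are obtained by multiplying with the scalar -1. As an abelian subgroup, N gets
  the calculus of additive cosets.\<close>

lemma submodule_abelian_subgroup:
  assumes "submodule R N M" shows "abelian_subgroup N M"
proof -
  interpret N: submodule R N M by fact
  interpret M: Module.module R M by (rule N.module)
  have "\<ominus>\<^bsub>M\<^esub> x \<in> N" if "x \<in> N" for x
  proof -
    have "x \<in> carrier M" using N.subset that by (rule subsetD)
    then have "\<ominus>\<^bsub>M\<^esub> x = (\<ominus>\<^bsub>R\<^esub> \<one>\<^bsub>R\<^esub>) \<odot>\<^bsub>M\<^esub> x" by (simp add: M.smult_minus_1)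
    also have "\<dots> \<in> N" using that by (intro N.smult_closed) simp_all
    finally show ?thesis .
  qed
  then have "subgroup N (add_monoid M)"
    using N.subset by (intro subgroup.intro) (simp_all flip: a_inv_def)
  then have "additive_subgroup N M"
    by (rule additive_subgroup.intro)
  then show ?thesis
    by (intro abelian_subgroupI3 M.M.abelian_group_axioms)
qed

context
  fixes R :: "('r, 'c) ring_scheme" and M :: "('r, 'a) module" and N
  assumes N: "submodule R N M"
begin

interpretation N: submodule R N M by (rule N)
interpretation M: Module.module R M by (rule N.module)
interpretation N: abelian_subgroup N M using N by (rule submodule_abelian_subgroup)

lemma quot_module_carrier: "carrier (quot_module M N) = (\<lambda>x. N +>\<^bsub>M\<^esub> x) ` carrier M"
  by (auto simp: A_RCOSETS_def')

lemma quot_module_coset_eq_iff: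
  assumes "x \<in> carrier M" "y \<in> carrier M"
  shows "N +>\<^bsub>M\<^esub> x = N +>\<^bsub>M\<^esub> y \<longleftrightarrow> x \<ominus>\<^bsub>M\<^esub> y \<in> N"
proof
  assume "N +>\<^bsub>M\<^esub> x = N +>\<^bsub>M\<^esub> y"
  with N.a_rcos_self[OF assms(1)] show "x \<ominus>\<^bsub>M\<^esub> y \<in> N"
    using N.a_rcos_module[OF assms(2,1)] by (simp add: a_minus_def)
next
  assume "x \<ominus>\<^bsub>M\<^esub> y \<in> N"
  then have "x \<in> N +>\<^bsub>M\<^esub> y"
    using N.a_rcos_module[OF assms(2,1)] by (simp add: a_minus_def)
  with assms(2) show "N +>\<^bsub>M\<^esub> x = N +>\<^bsub>M\<^esub> y"
    using N.a_repr_independence' by metis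
qed

lemma quot_module_add:
  assumes "x \<in> carrier M" "y \<in> carrier M"
  shows "N +>\<^bsub>M\<^esub> (x \<oplus>\<^bsub>M\<^esub> y) = (N +>\<^bsub>M\<^esub> x) \<oplus>\<^bsub>quot_module M N\<^esub> (N +>\<^bsub>M\<^esub> y)"
  using assms by (simp add: N.a_rcos_sum)

lemma quot_module_zero: "N +>\<^bsub>M\<^esub> \<zero>\<^bsub>M\<^esub> = \<zero>\<^bsub>quot_module M N\<^esub>"
  using N.a_subset by (simp add: M.M.a_coset_add_zero)

lemma quot_module_smult:
  assumes r: "r \<in> carrier R" and x: "x \<in> carrier M"
  shows "N +>\<^bsub>M\<^esub> (r \<odot>\<^bsub>M\<^esub> x) = r \<odot>\<^bsub>quot_module M N\<^esub> (N +>\<^bsub>M\<^esub> x)"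
proof -
  \<comment> \<open>The scalar multiple of a coset is defined as a union over all of its elements.
    It is a single coset because every element contributes the same one.\<close>
  have const: "N +>\<^bsub>M\<^esub> (r \<odot>\<^bsub>M\<^esub> y) = N +>\<^bsub>M\<^esub> (r \<odot>\<^bsub>M\<^esub> x)" if mem: "y \<in> N +>\<^bsub>M\<^esub> x" for y
  proof -
    obtain h where h: "h \<in> N" and y: "y = h \<oplus>\<^bsub>M\<^esub> x"
      using mem unfolding a_r_coset_def' UN_iff singleton_iff by (elim bexE)
    have "h \<in> carrier M" using N.subset h by (rule subsetD)
    then have "r \<odot>\<^bsub>M\<^esub> y = r \<odot>\<^bsub>M\<^esub> h \<oplus>\<^bsub>M\<^esub> r \<odot>\<^bsub>M\<^esub> x"
      unfolding y using r x by (intro M.smult_r_distr)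
    then have "r \<odot>\<^bsub>M\<^esub> y \<in> N +>\<^bsub>M\<^esub> (r \<odot>\<^bsub>M\<^esub> x)"
      unfolding a_r_coset_def' UN_iff singleton_iff using N.smult_closed[OF r h] by (rule bexI)
    then show ?thesis using M.smult_closed[OF r x] by (rule N.a_repr_independence'[symmetric])
  qed
  have "N +>\<^bsub>M\<^esub> x \<noteq> {}" using N.a_rcos_self[OF x] by force
  then have "(\<Union>y\<in>N +>\<^bsub>M\<^esub> x. N +>\<^bsub>M\<^esub> (r \<odot>\<^bsub>M\<^esub> y)) = N +>\<^bsub>M\<^esub> (r \<odot>\<^bsub>M\<^esub> x)"
    using const by (rule SUP_eq_const)
  then show ?thesis unfolding smult_quot_module by (rule sym)
qed

lemma quot_module_module: "module R (quot_module M N)"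
proof (rule module_image[OF N.module])
  show "(\<lambda>x. N +>\<^bsub>M\<^esub> x) ` carrier M = carrier (quot_module M N)"
    by (rule quot_module_carrier[symmetric])
qed (erule (1) quot_module_add quot_module_smult | rule quot_module_zero)+

lemma quot_module_hom: "(\<lambda>x. N +>\<^bsub>M\<^esub> x) \<in> LinearCombinations.module_hom R M (quot_module M N)"
proof -
  have "N +>\<^bsub>M\<^esub> x \<in> carrier (quot_module M N)" if "x \<in> carrier M" for x
    unfolding quot_module_carrier using that by (rule imageI)
  then have "(\<lambda>x. N +>\<^bsub>M\<^esub> x) \<in> carrier M \<rightarrow> carrier (quot_module M N)"
    by (rule funcsetI)
  moreover have "\<forall>x y. x \<in> carrier M \<and> y \<in> carrier M \<longrightarrow>
      N +>\<^bsub>M\<^esub> (x \<oplus>\<^bsub>M\<^esub> y) = (N +>\<^bsub>M\<^esub> x) \<oplus>\<^bsub>quot_module M N\<^esub> (N +>\<^bsub>M\<^esub> y)"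
    using quot_module_add by metis
  moreover have "\<forall>r x. r \<in> carrier R \<and> x \<in> carrier M \<longrightarrow>
      N +>\<^bsub>M\<^esub> (r \<odot>\<^bsub>M\<^esub> x) = r \<odot>\<^bsub>quot_module M N\<^esub> (N +>\<^bsub>M\<^esub> x)"
    using quot_module_smult by metis
  ultimately show ?thesis
    unfolding LinearCombinations.module_hom_def mem_Collect_eq by (intro conjI)
qed

end

lemma restrict_scalars_module:
  assumes "algebra K A" "module A M"
  shows "module K (restrict_scalars A M)"
proof -
  interpret A: algebra K A by fact
  interpret M: Module.module A M by fact
  have one: "\<one>\<^bsub>K\<^esub> \<odot>\<^bsub>A\<^esub> \<one>\<^bsub>A\<^esub> = \<one>\<^bsub>A\<^esub>" by simp
  have mult: "(a \<otimes>\<^bsub>K\<^esub> b) \<odot>\<^bsub>A\<^esub> \<one>\<^bsub>A\<^esub> = (a \<odot>\<^bsub>A\<^esub> \<one>\<^bsub>A\<^esub>) \<otimes>\<^bsub>A\<^esub> (b \<odot>\<^bsub>A\<^esub> \<one>\<^bsub>A\<^esub>)"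
    if "a \<in> carrier K" "b \<in> carrier K" for a b
    using that by (simp add: A.smult_assoc1 A.smult_assoc2)
  show ?thesis
  proof (rule moduleI)
    show "abelian_group (restrict_scalars A M)"
    proof (rule abelian_groupI)
      show "\<exists>y\<in>carrier (restrict_scalars A M). y \<oplus>\<^bsub>restrict_scalars A M\<^esub> x = \<zero>\<^bsub>restrict_scalars A M\<^esub>"
        if "x \<in> carrier (restrict_scalars A M)" for x
        using that by (intro bexI[of _ "\<ominus>\<^bsub>M\<^esub> x"]) (simp_all add: M.M.l_neg)
    qed (simp_all add: M.M.a_ac)
  qed (simp_all add: A.R.cring_axioms A.smult_l_distr M.smult_l_distr M.smult_r_distr mult M.smult_assoc1)
qed

section \<open>The module of Kaehler differentials\<close>

lemma free_module_simps [simp]: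
  "zero (free_module A) = (\<lambda>s. \<zero>\<^bsub>A\<^esub>)"
  "add (free_module A) = (\<lambda>\<phi> \<psi> s. \<phi> s \<oplus>\<^bsub>A\<^esub> \<psi> s)"
  "smult (free_module A) = (\<lambda>r \<phi> s. r \<otimes>\<^bsub>A\<^esub> \<phi> s)"
  by (simp_all add: free_module_def)

lemma free_module_carrier:
  "\<phi> \<in> carrier (free_module A) \<longleftrightarrow> (\<forall>s\<in>carrier A. \<phi> s \<in> carrier A) \<and>
     (\<forall>s. s \<notin> carrier A \<longrightarrow> \<phi> s = \<zero>\<^bsub>A\<^esub>) \<and> finite {s. \<phi> s \<noteq> \<zero>\<^bsub>A\<^esub>}"
  by (simp add: free_module_def)

context
  fixes A :: "('k::field, 'a) module"
  assumes A: "algebra class_ring A"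
begin

interpretation A': cring A using A by (rule algebra.M_cring)
interpretation A: algebra class_ring A by (rule A)

lemma free_module_value: "\<phi> \<in> carrier (free_module A) \<Longrightarrow> \<phi> s \<in> carrier A"
  by (cases "s \<in> carrier A") (simp_all add: free_module_carrier)

lemma free_module_add_closed:
  assumes "\<phi> \<in> carrier (free_module A)" "\<psi> \<in> carrier (free_module A)"
  shows "(\<lambda>s. \<phi> s \<oplus>\<^bsub>A\<^esub> \<psi> s) \<in> carrier (free_module A)"
proof -
  have "{s. \<phi> s \<oplus>\<^bsub>A\<^esub> \<psi> s \<noteq> \<zero>\<^bsub>A\<^esub>} \<subseteq> {s. \<phi> s \<noteq> \<zero>\<^bsub>A\<^esub>} \<union> {s. \<psi> s \<noteq> \<zero>\<^bsub>A\<^esub>}"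
    by auto
  from finite_subset[OF this] show ?thesis
    using assms by (auto simp: free_module_carrier)
qed

lemma free_module_smult_closed:
  assumes "r \<in> carrier A" "\<phi> \<in> carrier (free_module A)"
  shows "(\<lambda>s. r \<otimes>\<^bsub>A\<^esub> \<phi> s) \<in> carrier (free_module A)"
proof -
  have "{s. r \<otimes>\<^bsub>A\<^esub> \<phi> s \<noteq> \<zero>\<^bsub>A\<^esub>} \<subseteq> {s. \<phi> s \<noteq> \<zero>\<^bsub>A\<^esub>}"
    using assms(1) by auto
  from finite_subset[OF this] show ?thesis
    using assms by (auto simp: free_module_carrier)
qed

lemma dsym_closed: "s \<in> carrier A \<Longrightarrow> dsym A s \<in> carrier (free_module A)"
  by (auto simp: free_module_carrier dsym_def)

lemma free_module_module: "module A (free_module A)"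
proof (rule moduleI)
  show "abelian_group (free_module A)"
  proof (rule abelian_groupI)
    show "\<exists>\<psi>\<in>carrier (free_module A). \<psi> \<oplus>\<^bsub>free_module A\<^esub> \<phi> = \<zero>\<^bsub>free_module A\<^esub>"
      if "\<phi> \<in> carrier (free_module A)" for \<phi>
    proof (rule bexI)
      show "(\<lambda>s. (\<ominus>\<^bsub>A\<^esub> \<one>\<^bsub>A\<^esub>) \<otimes>\<^bsub>A\<^esub> \<phi> s) \<in> carrier (free_module A)"
        using that by (intro free_module_smult_closed) simp_all
      show "(\<lambda>s. (\<ominus>\<^bsub>A\<^esub> \<one>\<^bsub>A\<^esub>) \<otimes>\<^bsub>A\<^esub> \<phi> s) \<oplus>\<^bsub>free_module A\<^esub> \<phi> = \<zero>\<^bsub>free_module A\<^esub>"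
        using that by (simp add: fun_eq_iff free_module_value A'.l_minus A'.l_neg)
    qed
  qed (simp_all add: free_module_add_closed fun_eq_iff free_module_value A'.a_ac, simp add: free_module_carrier)
qed (simp_all add: A.M_cring free_module_smult_closed fun_eq_iff free_module_value
      A'.l_distr A'.r_distr A'.m_assoc)

interpretation F: Module.module A "free_module A" by (rule free_module_module)

section \<open>The defining relations and the universal derivation\<close>

lemma kaehler_relations_subset: "kaehler_relations A \<subseteq> carrier (free_module A)"
proof -
  have smult: "r \<odot>\<^bsub>free_module A\<^esub> dsym A s \<in> carrier (free_module A)"
    if "r \<in> carrier A" "s \<in> carrier A" for r s
    using that by (intro F.smult_closed dsym_closed)
  show ?thesis
    unfolding kaehler_relations_def Let_def
    by (intro subsetI; elim UnE CollectE exE conjE; hypsubst)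
      (auto intro!: F.M.minus_closed F.M.add.m_closed dsym_closed smult A.smult_closed simp del: free_module_simps)
qed

lemma kaehler_submodule: "submodule A (kaehler_submodule A) (free_module A)"
  unfolding kaehler_submodule_def using kaehler_relations_subset by (rule F.span_is_submodule)

lemma kaehler_relations_in_submodule: "kaehler_relations A \<subseteq> kaehler_submodule A"
  unfolding kaehler_submodule_def using kaehler_relations_subset by (rule F.in_own_span)

lemma kaehler_module_module: "module A (kaehler_module A)"
  unfolding kaehler_module_def using kaehler_submodule by (rule quot_module_module)

lemma kaehler_d_closed: "s \<in> carrier A \<Longrightarrow> kaehler_d A s \<in> carrier (kaehler_module A)"
  unfolding kaehler_module_def kaehler_d_def quot_module_carrier[OF kaehler_submodule]
  by (intro imageI dsym_closed)

lemma kaehler_d_smult: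
  assumes "r \<in> carrier A" "s \<in> carrier A"
  shows "r \<odot>\<^bsub>kaehler_module A\<^esub> kaehler_d A s =
    kaehler_submodule A +>\<^bsub>free_module A\<^esub> (r \<odot>\<^bsub>free_module A\<^esub> dsym A s)"
  unfolding kaehler_module_def kaehler_d_def
  using quot_module_smult[OF kaehler_submodule assms(1) dsym_closed[OF assms(2)]] by (rule sym)

text \<open>Every generating relation has the form x minus y, so it identifies two cosets. The rules
  for \<open>kaehler_d\<close> on sums, scalar multiples and products are three instances.\<close>

lemma kaehler_coset_eqI:
  assumes "x \<ominus>\<^bsub>free_module A\<^esub> y \<in> kaehler_relations A"
    and "x \<in> carrier (free_module A)" "y \<in> carrier (free_module A)"
  shows "kaehler_submodule A +>\<^bsub>free_module A\<^esub> x = kaehler_submodule A +>\<^bsub>free_module A\<^esub> y"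
  using quot_module_coset_eq_iff[OF kaehler_submodule assms(2,3)] kaehler_relations_in_submodule assms(1)
  by (simp del: free_module_simps add: subset_iff)

lemma kaehler_d_add:
  assumes "s \<in> carrier A" "t \<in> carrier A"
  shows "kaehler_d A (s \<oplus>\<^bsub>A\<^esub> t) = kaehler_d A s \<oplus>\<^bsub>kaehler_module A\<^esub> kaehler_d A t"
proof -
  have "kaehler_d A (s \<oplus>\<^bsub>A\<^esub> t) =
      kaehler_submodule A +>\<^bsub>free_module A\<^esub> (dsym A s \<oplus>\<^bsub>free_module A\<^esub> dsym A t)"
    unfolding kaehler_d_def
  proof (rule kaehler_coset_eqI)
    show "dsym A (s \<oplus>\<^bsub>A\<^esub> t) \<ominus>\<^bsub>free_module A\<^esub> (dsym A s \<oplus>\<^bsub>free_module A\<^esub> dsym A t) \<in> kaehler_relations A"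
      unfolding kaehler_relations_def Let_def using assms by blast
  qed (use assms in \<open>auto intro!: dsym_closed F.M.add.m_closed simp del: free_module_simps\<close>)
  then show ?thesis
    unfolding kaehler_module_def kaehler_d_def
    using quot_module_add[OF kaehler_submodule dsym_closed[OF assms(1)] dsym_closed[OF assms(2)]]
    by (simp only:)
qed

lemma kaehler_d_scalar:
  assumes "s \<in> carrier A"
  shows "kaehler_d A (c \<odot>\<^bsub>A\<^esub> s) = (c \<odot>\<^bsub>A\<^esub> \<one>\<^bsub>A\<^esub>) \<odot>\<^bsub>kaehler_module A\<^esub> kaehler_d A s"
proof -
  have c: "c \<odot>\<^bsub>A\<^esub> \<one>\<^bsub>A\<^esub> \<in> carrier A" "c \<odot>\<^bsub>A\<^esub> s \<in> carrier A" using assms by (auto intro!: A.smult_closed)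
  have "kaehler_d A (c \<odot>\<^bsub>A\<^esub> s) =
      kaehler_submodule A +>\<^bsub>free_module A\<^esub> ((c \<odot>\<^bsub>A\<^esub> \<one>\<^bsub>A\<^esub>) \<odot>\<^bsub>free_module A\<^esub> dsym A s)"
    unfolding kaehler_d_def
  proof (rule kaehler_coset_eqI)
    show "dsym A (c \<odot>\<^bsub>A\<^esub> s) \<ominus>\<^bsub>free_module A\<^esub> ((c \<odot>\<^bsub>A\<^esub> \<one>\<^bsub>A\<^esub>) \<odot>\<^bsub>free_module A\<^esub> dsym A s) \<in> kaehler_relations A"
      unfolding kaehler_relations_def Let_def using assms by blast
  qed (use assms c in \<open>auto intro!: dsym_closed F.smult_closed simp del: free_module_simps\<close>)
  then show ?thesis
    using kaehler_d_smult[OF c(1) assms(1)] by (simp only:)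
qed

lemma kaehler_d_mult:
  assumes "s \<in> carrier A" "t \<in> carrier A"
  shows "kaehler_d A (s \<otimes>\<^bsub>A\<^esub> t) = s \<odot>\<^bsub>kaehler_module A\<^esub> kaehler_d A t
    \<oplus>\<^bsub>kaehler_module A\<^esub> t \<odot>\<^bsub>kaehler_module A\<^esub> kaehler_d A s"
proof -
  let ?F = "free_module A"
  have cl: "s \<odot>\<^bsub>?F\<^esub> dsym A t \<in> carrier ?F" "t \<odot>\<^bsub>?F\<^esub> dsym A s \<in> carrier ?F"
    using F.smult_closed[OF assms(1) dsym_closed[OF assms(2)]] F.smult_closed[OF assms(2) dsym_closed[OF assms(1)]] .
  have "kaehler_d A (s \<otimes>\<^bsub>A\<^esub> t) =
      kaehler_submodule A +>\<^bsub>?F\<^esub> (s \<odot>\<^bsub>?F\<^esub> dsym A t \<oplus>\<^bsub>?F\<^esub> t \<odot>\<^bsub>?F\<^esub> dsym A s)"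
    unfolding kaehler_d_def
  proof (rule kaehler_coset_eqI)
    show "dsym A (s \<otimes>\<^bsub>A\<^esub> t) \<ominus>\<^bsub>?F\<^esub> (s \<odot>\<^bsub>?F\<^esub> dsym A t \<oplus>\<^bsub>?F\<^esub> t \<odot>\<^bsub>?F\<^esub> dsym A s) \<in> kaehler_relations A"
      unfolding kaehler_relations_def Let_def using assms by (intro UnI2 CollectI exI[of _ s] exI[of _ t] conjI refl)
    show "s \<odot>\<^bsub>?F\<^esub> dsym A t \<oplus>\<^bsub>?F\<^esub> t \<odot>\<^bsub>?F\<^esub> dsym A s \<in> carrier ?F"
      using cl by (rule F.M.add.m_closed)
  qed (rule dsym_closed[OF A'.m_closed[OF assms]])
  also have "\<dots> = (kaehler_submodule A +>\<^bsub>?F\<^esub> (s \<odot>\<^bsub>?F\<^esub> dsym A t))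
      \<oplus>\<^bsub>kaehler_module A\<^esub> (kaehler_submodule A +>\<^bsub>?F\<^esub> (t \<odot>\<^bsub>?F\<^esub> dsym A s))"
    unfolding kaehler_module_def using quot_module_add[OF kaehler_submodule cl] .
  finally show ?thesis
    using kaehler_d_smult[OF assms] kaehler_d_smult[OF assms(2,1)] by (simp only:)
qed

end

section \<open>The coordinate ring\<close>

lemma poly_ring_a_inv [simp]: "f \<in> carrier (poly_ring n) \<Longrightarrow> \<ominus>\<^bsub>poly_ring n\<^esub> f = - f"
proof -
  interpret algebra class_ring "poly_ring n :: ('a, 'a polynomial) module" by (rule poly_ring_algebra)
  assume "f \<in> carrier (poly_ring n)"
  then show ?thesis
    using M.minus_equality[of "- f" f] by (simp add: poly_ring_uminus)
qed

lemma poly_ring_a_minus [simp]: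
  "g \<in> carrier (poly_ring n) \<Longrightarrow> f \<ominus>\<^bsub>poly_ring n\<^esub> g = f - g"
  by (simp add: a_minus_def)

text \<open>
  The relations among the differentials: \<open>\<Sum>\<^sub>k u\<^sub>k dX\<^sub>k = 0\<close> over the coordinate ring if and only if
  \<open>u\<close> is congruent modulo \<open>I\<close> to the gradient of an element of \<open>I\<close>.
\<close>

definition gradient_relation :: "nat \<Rightarrow> 'k::field polynomial set \<Rightarrow> (nat \<Rightarrow> 'k polynomial) \<Rightarrow> bool" where
  "gradient_relation n I u \<longleftrightarrow> (\<exists>f\<in>I. \<forall>k\<le>n. u k - partial_deriv k f \<in> I)"

context
  fixes n :: nat and I :: "'k::field polynomial set"
  assumes I: "ideal I (poly_ring n)"
begin

interpretation P: algebra class_ring "poly_ring n :: ('k, 'k polynomial) module" by (rule poly_ring_algebra)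
interpretation I: ideal I "poly_ring n" by (rule I)

lemma ideal_subset: "f \<in> I \<Longrightarrow> f \<in> carrier (poly_ring n)"
  by (rule I.Icarr)

lemma ideal_zero: "0 \<in> I"
  using I.zero_closed by simp

lemma ideal_add: "f \<in> I \<Longrightarrow> g \<in> I \<Longrightarrow> f + g \<in> I"
  using I.a_closed by simp

lemma ideal_mult: "p \<in> carrier (poly_ring n) \<Longrightarrow> f \<in> I \<Longrightarrow> p * f \<in> I"
  using I.I_l_closed[of f p] by simp

lemma ideal_uminus: "f \<in> I \<Longrightarrow> - f \<in> I"
  using ideal_mult[of "- 1" f] by (simp add: poly_ring_uminus)

lemma ideal_diff: "f \<in> I \<Longrightarrow> g \<in> I \<Longrightarrow> f - g \<in> I"
  using ideal_add[OF _ ideal_uminus, of f g] by simp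

lemma ideal_sum: "(\<And>a. a \<in> S \<Longrightarrow> h a \<in> I) \<Longrightarrow> (\<Sum>a\<in>S. h a) \<in> I"
  by (induction S rule: infinite_finite_induct) (simp_all add: ideal_zero ideal_add)

lemma ideal_submodule: "submodule class_ring I (poly_ring n)"
  by (rule submodule.intro)
    (simp_all add: P.module subsetI ideal_subset ideal_add ideal_zero ideal_mult)

abbreviation (input) residue :: "'k polynomial \<Rightarrow> 'k polynomial set" where
  "residue f \<equiv> I +>\<^bsub>poly_ring n\<^esub> f"

lemma coord_ring_carrier: "carrier (coord_ring n I) = residue ` carrier (poly_ring n)"
  unfolding coord_ring_def by (rule quot_module_carrier[OF ideal_submodule])

lemma residue_closed: "f \<in> carrier (poly_ring n) \<Longrightarrow> residue f \<in> carrier (coord_ring n I)"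
  unfolding coord_ring_carrier by (rule imageI)

lemma residue_eq_iff:
  "f \<in> carrier (poly_ring n) \<Longrightarrow> g \<in> carrier (poly_ring n) \<Longrightarrow> residue f = residue g \<longleftrightarrow> f - g \<in> I"
  using quot_module_coset_eq_iff[OF ideal_submodule, of f g] by simp

lemma residue_add:
  "f \<in> carrier (poly_ring n) \<Longrightarrow> g \<in> carrier (poly_ring n) \<Longrightarrow> residue (f + g) = residue f \<oplus>\<^bsub>coord_ring n I\<^esub> residue g"
  unfolding coord_ring_def using quot_module_add[OF ideal_submodule, of f g] by simp

lemma residue_mult:
  "f \<in> carrier (poly_ring n) \<Longrightarrow> g \<in> carrier (poly_ring n) \<Longrightarrow> residue (f * g) = residue f \<otimes>\<^bsub>coord_ring n I\<^esub> residue g"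
  using I.rcoset_mult_add[of f g] by (simp add: coord_ring_def)

lemma residue_smult:
  "f \<in> carrier (poly_ring n) \<Longrightarrow> residue (Poly_Mapping.single 0 c * f) = c \<odot>\<^bsub>coord_ring n I\<^esub> residue f"
  unfolding coord_ring_def using quot_module_smult[OF ideal_submodule, of c f] by simp

lemma residue_zero: "residue 0 = \<zero>\<^bsub>coord_ring n I\<^esub>"
  unfolding coord_ring_def using quot_module_zero[OF ideal_submodule] by simp

lemma residue_one: "residue 1 = \<one>\<^bsub>coord_ring n I\<^esub>"
  by (simp add: coord_ring_def)

lemma residue_const: "residue (Poly_Mapping.single 0 c) = c \<odot>\<^bsub>coord_ring n I\<^esub> \<one>\<^bsub>coord_ring n I\<^esub>"
  using residue_smult[of 1 c] by (simp add: residue_one)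

lemma residue_eq_zero_iff: "f \<in> carrier (poly_ring n) \<Longrightarrow> residue f = \<zero>\<^bsub>coord_ring n I\<^esub> \<longleftrightarrow> f \<in> I"
  using residue_eq_iff[of f 0] by (simp add: residue_zero)

lemma coord_ring_module: "module class_ring (coord_ring n I)"
  unfolding coord_ring_def by (rule quot_module_module[OF ideal_submodule])

text \<open>The general quotient construction supplies only the module axioms; those involving the
  product are checked on representatives.\<close>

lemma coord_ring_algebra: "algebra class_ring (coord_ring n I)"
proof -
  interpret R: Module.module class_ring "coord_ring n I" by (rule coord_ring_module)
  have ex: "\<exists>f\<in>carrier (poly_ring n). x = residue f" if "x \<in> carrier (coord_ring n I)" for x
    using that unfolding coord_ring_carrier by (rule imageE) (rule bexI)
  have "comm_monoid (coord_ring n I)"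
  proof (rule comm_monoidI)
    fix x y z assume "x \<in> carrier (coord_ring n I)" "y \<in> carrier (coord_ring n I)" "z \<in> carrier (coord_ring n I)"
    with ex obtain f g h where "f \<in> carrier (poly_ring n)" "g \<in> carrier (poly_ring n)"
      "h \<in> carrier (poly_ring n)" "x = residue f" "y = residue g" "z = residue h" by metis
    then show "x \<otimes>\<^bsub>coord_ring n I\<^esub> y \<otimes>\<^bsub>coord_ring n I\<^esub> z = x \<otimes>\<^bsub>coord_ring n I\<^esub> (y \<otimes>\<^bsub>coord_ring n I\<^esub> z)"
      by (simp add: poly_ring_closed mult.assoc flip: residue_mult)
  next
    fix x y assume "x \<in> carrier (coord_ring n I)" "y \<in> carrier (coord_ring n I)"
    with ex obtain f g where "f \<in> carrier (poly_ring n)" "g \<in> carrier (poly_ring n)"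
      "x = residue f" "y = residue g" by metis
    then show "x \<otimes>\<^bsub>coord_ring n I\<^esub> y \<in> carrier (coord_ring n I)" "x \<otimes>\<^bsub>coord_ring n I\<^esub> y = y \<otimes>\<^bsub>coord_ring n I\<^esub> x"
      by (simp_all add: poly_ring_closed mult.commute residue_closed flip: residue_mult)
  next
    fix x assume "x \<in> carrier (coord_ring n I)"
    with ex obtain f where "f \<in> carrier (poly_ring n)" "x = residue f" by metis
    then show "\<one>\<^bsub>coord_ring n I\<^esub> \<otimes>\<^bsub>coord_ring n I\<^esub> x = x"
      by (simp flip: residue_mult residue_one)
  qed (simp add: residue_closed flip: residue_one)
  then have "cring (coord_ring n I)"
  proof (rule cringI[OF R.M.abelian_group_axioms])
    fix x y z assume "x \<in> carrier (coord_ring n I)" "y \<in> carrier (coord_ring n I)" "z \<in> carrier (coord_ring n I)"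
    with ex obtain f g h where "f \<in> carrier (poly_ring n)" "g \<in> carrier (poly_ring n)"
      "h \<in> carrier (poly_ring n)" "x = residue f" "y = residue g" "z = residue h" by metis
    then show "(x \<oplus>\<^bsub>coord_ring n I\<^esub> y) \<otimes>\<^bsub>coord_ring n I\<^esub> z = x \<otimes>\<^bsub>coord_ring n I\<^esub> z \<oplus>\<^bsub>coord_ring n I\<^esub> y \<otimes>\<^bsub>coord_ring n I\<^esub> z"
      by (simp add: poly_ring_closed distrib_right flip: residue_mult residue_add)
  qed
  then show ?thesis
  proof (rule algebraI[OF class_cring.cring_axioms])
    fix a :: 'k and x y assume "x \<in> carrier (coord_ring n I)" "y \<in> carrier (coord_ring n I)"
    with ex obtain f g where "f \<in> carrier (poly_ring n)" "g \<in> carrier (poly_ring n)"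
      "x = residue f" "y = residue g" by metis
    then show "(a \<odot>\<^bsub>coord_ring n I\<^esub> x) \<otimes>\<^bsub>coord_ring n I\<^esub> y = a \<odot>\<^bsub>coord_ring n I\<^esub> (x \<otimes>\<^bsub>coord_ring n I\<^esub> y)"
      by (simp add: poly_ring_closed mult.assoc flip: residue_mult residue_smult)
  qed (simp_all only: R.smult_closed R.smult_l_distr R.smult_r_distr R.smult_assoc1 R.smult_one)
qed

section \<open>Differentials of a coordinate ring\<close>

interpretation \<Omega>: Module.module "coord_ring n I" "kaehler_module (coord_ring n I)"
  using coord_ring_algebra by (rule kaehler_module_module)

abbreviation (input) diff :: "'k polynomial \<Rightarrow> ('k polynomial set \<Rightarrow> 'k polynomial set) set" where
  "diff f \<equiv> kaehler_d (coord_ring n I) (residue f)"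

text \<open>The coefficients are polynomials rather than residue classes, so that the same tuples
  can be fed into the map for different ideals.\<close>

definition diff_form :: "(nat \<Rightarrow> 'k polynomial) \<Rightarrow> ('k polynomial set \<Rightarrow> 'k polynomial set) set" where
  "diff_form u = (\<Oplus>\<^bsub>kaehler_module (coord_ring n I)\<^esub>k\<in>{..n}.
     residue (u k) \<odot>\<^bsub>kaehler_module (coord_ring n I)\<^esub> diff (indet k))"

lemma indet_closed [simp]: "k \<le> n \<Longrightarrow> indet k \<in> carrier (poly_ring n)"
  using indet_in_forms forms_subset by blast

lemma diff_closed: "f \<in> carrier (poly_ring n) \<Longrightarrow> diff f \<in> carrier (kaehler_module (coord_ring n I))"
  by (intro kaehler_d_closed coord_ring_algebra residue_closed)

lemma diff_term_closed:
  "f \<in> carrier (poly_ring n) \<Longrightarrow> g \<in> carrier (poly_ring n) \<Longrightarrow>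
    residue f \<odot>\<^bsub>kaehler_module (coord_ring n I)\<^esub> diff g \<in> carrier (kaehler_module (coord_ring n I))"
  by (intro \<Omega>.smult_closed residue_closed diff_closed)

lemma diff_form_closed:
  "(\<And>k. k \<le> n \<Longrightarrow> u k \<in> carrier (poly_ring n)) \<Longrightarrow> diff_form u \<in> carrier (kaehler_module (coord_ring n I))"
  unfolding diff_form_def by (intro \<Omega>.M.finsum_closed Pi_I diff_term_closed) auto

lemma diff_form_add:
  assumes "\<And>k. k \<le> n \<Longrightarrow> u k \<in> carrier (poly_ring n)" "\<And>k. k \<le> n \<Longrightarrow> v k \<in> carrier (poly_ring n)"
  shows "diff_form (\<lambda>k. u k + v k) = diff_form u \<oplus>\<^bsub>kaehler_module (coord_ring n I)\<^esub> diff_form v"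
proof -
  have "diff_form (\<lambda>k. u k + v k) = (\<Oplus>\<^bsub>kaehler_module (coord_ring n I)\<^esub>k\<in>{..n}.
      residue (u k) \<odot>\<^bsub>kaehler_module (coord_ring n I)\<^esub> diff (indet k)
      \<oplus>\<^bsub>kaehler_module (coord_ring n I)\<^esub> residue (v k) \<odot>\<^bsub>kaehler_module (coord_ring n I)\<^esub> diff (indet k))"
    unfolding diff_form_def
    by (intro \<Omega>.M.finsum_cong')
      (simp_all add: assms residue_add \<Omega>.smult_l_distr residue_closed diff_closed)
  then show ?thesis
    unfolding diff_form_def using \<Omega>.M.finsum_addf[of _ "{..n}"] assms diff_term_closed by simp
qed

lemma diff_form_smult:
  assumes "p \<in> carrier (poly_ring n)" "\<And>k. k \<le> n \<Longrightarrow> u k \<in> carrier (poly_ring n)"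
  shows "diff_form (\<lambda>k. p * u k) = residue p \<odot>\<^bsub>kaehler_module (coord_ring n I)\<^esub> diff_form u"
proof -
  have "diff_form (\<lambda>k. p * u k) = (\<Oplus>\<^bsub>kaehler_module (coord_ring n I)\<^esub>k\<in>{..n}.
      residue p \<odot>\<^bsub>kaehler_module (coord_ring n I)\<^esub>
        (residue (u k) \<odot>\<^bsub>kaehler_module (coord_ring n I)\<^esub> diff (indet k)))"
    unfolding diff_form_def
    by (intro \<Omega>.M.finsum_cong')
      (simp_all add: assms residue_mult \<Omega>.smult_assoc1 residue_closed diff_closed)
  then show ?thesis
    unfolding diff_form_def
    using \<Omega>.finsum_smult_ldistr[of "{..n}" "residue p"] assms diff_term_closed residue_closed by simp
qed

lemma diff_form_cong:
  assumes "\<And>k. k \<le> n \<Longrightarrow> u k \<in> carrier (poly_ring n)" "\<And>k. k \<le> n \<Longrightarrow> v k \<in> carrier (poly_ring n)"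
    and "\<And>k. k \<le> n \<Longrightarrow> u k - v k \<in> I"
  shows "diff_form u = diff_form v"
proof -
  have "residue (u k) = residue (v k)" if "k \<le> n" for k
    using residue_eq_iff assms that by simp
  then show ?thesis
    unfolding diff_form_def by (intro \<Omega>.M.finsum_cong') (simp_all add: Pi_I assms diff_term_closed)
qed

lemma diff_form_zero: "diff_form (\<lambda>k. 0) = \<zero>\<^bsub>kaehler_module (coord_ring n I)\<^esub>"
  unfolding diff_form_def residue_zero
  by (intro \<Omega>.M.add.finprod_one_eqI) (simp add: \<Omega>.smult_l_null diff_closed)

lemma diff_mult:
  assumes "f \<in> carrier (poly_ring n)" "g \<in> carrier (poly_ring n)"
  shows "diff (f * g) = residue f \<odot>\<^bsub>kaehler_module (coord_ring n I)\<^esub> diff g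
    \<oplus>\<^bsub>kaehler_module (coord_ring n I)\<^esub> residue g \<odot>\<^bsub>kaehler_module (coord_ring n I)\<^esub> diff f"
  using assms by (simp add: residue_mult residue_closed kaehler_d_mult[OF coord_ring_algebra])

lemma diff_const: "diff (Poly_Mapping.single 0 c) = \<zero>\<^bsub>kaehler_module (coord_ring n I)\<^esub>"
proof -
  \<comment> \<open>The Leibniz rule for the product 1 * 1; it forces d1 = 0, and linearity extends
    this to all constants.\<close>
  have "diff 1 = diff 1 \<oplus>\<^bsub>kaehler_module (coord_ring n I)\<^esub> diff 1"
    using diff_mult[of 1 1] diff_closed[of 1] by (simp add: residue_one)
  then have "diff 1 = \<zero>\<^bsub>kaehler_module (coord_ring n I)\<^esub>"
    using diff_closed[of 1] \<Omega>.M.add.r_cancel_one' by simp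
  then show ?thesis
    using kaehler_d_scalar[OF coord_ring_algebra, of "residue 1" c] residue_closed[of "Poly_Mapping.single 0 c"]
    by (simp add: residue_one residue_const \<Omega>.smult_r_null)
qed

text \<open>Both sides are derivations in f that vanish on constants and take X_k to dX_k. This is
  the half of the presentation which says that the dX_k generate.\<close>

lemma diff_expand:
  assumes "f \<in> carrier (poly_ring n)"
  shows "diff f = diff_form (\<lambda>k. partial_deriv k f)"
  using assms
proof (induction rule: poly_ring_induct)
  case (const c)
  then show ?case by (simp add: diff_const diff_form_zero)
next
  case (indet l)
  have "diff_form (\<lambda>k. partial_deriv k (indet l)) = (\<Oplus>\<^bsub>kaehler_module (coord_ring n I)\<^esub>k\<in>{..n}.
      if l = k then diff (indet k) else \<zero>\<^bsub>kaehler_module (coord_ring n I)\<^esub>)"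
    unfolding diff_form_def
    by (intro \<Omega>.M.finsum_cong')
      (auto simp: partial_deriv_indet residue_one residue_zero diff_closed)
  also have "\<dots> = diff (indet l)"
    using indet by (intro \<Omega>.M.add.finprod_singleton) (auto simp: diff_closed)
  finally show ?case by simp
next
  case (add f g)
  then show ?case
    by (simp add: partial_deriv_add diff_form_add partial_deriv_closed residue_add residue_closed
        kaehler_d_add[OF coord_ring_algebra])
next
  case (mult f g)
  then show ?case
    by (simp add: partial_deriv_mult diff_form_add diff_form_smult partial_deriv_closed poly_ring_closed diff_mult)
qed

section \<open>Gradient relations form a submodule\<close>

lemma gradient_relation_gradient: "f \<in> I \<Longrightarrow> gradient_relation n I (\<lambda>k. partial_deriv k f)"
  unfolding gradient_relation_def by (rule bexI[of _ f]) (simp_all add: ideal_zero)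

lemma gradient_relation_ideal: "(\<And>k. k \<le> n \<Longrightarrow> u k \<in> I) \<Longrightarrow> gradient_relation n I u"
  unfolding gradient_relation_def by (rule bexI[of _ 0]) (simp_all add: ideal_zero)

lemma gradient_relation_add:
  assumes "gradient_relation n I u" "gradient_relation n I v"
  shows "gradient_relation n I (\<lambda>k. u k + v k)"
proof -
  from assms obtain f g where "f \<in> I" "g \<in> I"
    and fg: "\<And>k. k \<le> n \<Longrightarrow> u k - partial_deriv k f \<in> I" "\<And>k. k \<le> n \<Longrightarrow> v k - partial_deriv k g \<in> I"
    unfolding gradient_relation_def by blast
  have "u k + v k - partial_deriv k (f + g) = (u k - partial_deriv k f) + (v k - partial_deriv k g)" for k
    by (simp add: partial_deriv_add)
  with fg have "u k + v k - partial_deriv k (f + g) \<in> I" if "k \<le> n" for k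
    using that by (simp only: ideal_add)
  then show ?thesis
    unfolding gradient_relation_def using ideal_add[OF \<open>f \<in> I\<close> \<open>g \<in> I\<close>] by blast
qed

text \<open>If u is congruent to the gradient of f, then p u is congruent to the gradient of p f:
  the extra term of the product rule is f times the gradient of p, and it has entries in I.\<close>

lemma gradient_relation_mult:
  assumes "gradient_relation n I u" and p: "p \<in> carrier (poly_ring n)"
  shows "gradient_relation n I (\<lambda>k. p * u k)"
proof -
  from assms obtain f where "f \<in> I" and f: "\<And>k. k \<le> n \<Longrightarrow> u k - partial_deriv k f \<in> I"
    unfolding gradient_relation_def by blast
  have eq: "p * u k - partial_deriv k (p * f) = p * (u k - partial_deriv k f) - partial_deriv k p * f" for k
    by (simp add: partial_deriv_mult algebra_simps)
  have "p * u k - partial_deriv k (p * f) \<in> I" if "k \<le> n" for k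
    unfolding eq using f[OF that] \<open>f \<in> I\<close> p by (simp only: ideal_diff ideal_mult partial_deriv_closed)
  then show ?thesis
    unfolding gradient_relation_def using ideal_mult[OF p \<open>f \<in> I\<close>] by blast
qed

lemma gradient_relation_uminus: "gradient_relation n I u \<Longrightarrow> gradient_relation n I (\<lambda>k. - u k)"
  using gradient_relation_mult[of u "- 1"] by (simp add: poly_ring_uminus)

text \<open>Transitivity of congruence modulo gradient relations, the form in which all later
  computations are chained.\<close>

lemma gradient_relation_trans:
  assumes "gradient_relation n I (\<lambda>k. u k - v k)" "gradient_relation n I (\<lambda>k. v k - w k)"
  shows "gradient_relation n I (\<lambda>k. u k - w k)"
  using gradient_relation_add[OF assms] by simp

text \<open>A section of the residue map. It is not additive, so \<open>free_gradient\<close> below is linear only modulo relations.\<close>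

definition rep :: "'k polynomial set \<Rightarrow> 'k polynomial" where
  "rep x = (if x = \<zero>\<^bsub>coord_ring n I\<^esub> then 0 else (SOME f. f \<in> carrier (poly_ring n) \<and> residue f = x))"

lemma rep:
  assumes "x \<in> carrier (coord_ring n I)"
  shows "rep x \<in> carrier (poly_ring n)" "residue (rep x) = x"
proof -
  have "\<exists>f. f \<in> carrier (poly_ring n) \<and> residue f = x"
    using assms unfolding coord_ring_carrier by auto
  from someI_ex[OF this] show "rep x \<in> carrier (poly_ring n)" "residue (rep x) = x"
    by (simp_all add: rep_def residue_zero)
qed

text \<open>Because zero is lifted to zero, sums over the support of an element of the free module
  can be extended to any larger finite set.\<close>

lemma rep_zero: "rep \<zero>\<^bsub>coord_ring n I\<^esub> = 0"
  by (simp add: rep_def)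

lemma rep_residue: "f \<in> carrier (poly_ring n) \<Longrightarrow> rep (residue f) - f \<in> I"
  using residue_eq_iff[of "rep (residue f)" f] rep[of "residue f"] residue_closed by simp

text \<open>Sends r ds to r times the gradient of s, computed on lifts. Modulo gradient relations it
  undoes \<open>diff_form\<close>.\<close>

definition free_gradient :: "('k polynomial set \<Rightarrow> 'k polynomial set) \<Rightarrow> nat \<Rightarrow> 'k polynomial" where
  "free_gradient \<phi> k = (\<Sum>s\<in>{s. \<phi> s \<noteq> \<zero>\<^bsub>coord_ring n I\<^esub>}. rep (\<phi> s) * partial_deriv k (rep s))"

text \<open>Two lifts of the same coefficient differ by an element of I, so replacing the chosen
  lifts by arbitrary ones changes each entry only by an element of I.\<close>

lemma free_gradient_cong:
  assumes S: "finite S" "S \<subseteq> carrier (coord_ring n I)" "\<And>s. s \<notin> S \<Longrightarrow> \<phi> s = \<zero>\<^bsub>coord_ring n I\<^esub>"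
    and p: "\<And>s. s \<in> S \<Longrightarrow> p s \<in> carrier (poly_ring n)" "\<And>s. s \<in> S \<Longrightarrow> residue (p s) = \<phi> s"
  shows "gradient_relation n I (\<lambda>k. free_gradient \<phi> k - (\<Sum>s\<in>S. p s * partial_deriv k (rep s)))"
proof (rule gradient_relation_ideal)
  fix k assume "k \<le> n"
  have "free_gradient \<phi> k = (\<Sum>s\<in>S. rep (\<phi> s) * partial_deriv k (rep s))"
    unfolding free_gradient_def using S(1,3) by (intro sum.mono_neutral_left) (auto simp: rep_zero)
  then have eq: "free_gradient \<phi> k - (\<Sum>s\<in>S. p s * partial_deriv k (rep s)) =
      (\<Sum>s\<in>S. partial_deriv k (rep s) * (rep (\<phi> s) - p s))"
    by (simp add: sum_subtractf algebra_simps)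
  have "rep (\<phi> s) - p s \<in> I" if "s \<in> S" for s
    using rep_residue[OF p(1)[OF that]] p(2)[OF that] by simp
  then show "free_gradient \<phi> k - (\<Sum>s\<in>S. p s * partial_deriv k (rep s)) \<in> I"
    unfolding eq using S(2) by (intro ideal_sum ideal_mult partial_deriv_closed rep(1)) auto
qed

interpretation F: Module.module "coord_ring n I" "free_module (coord_ring n I)"
  using coord_ring_algebra by (rule free_module_module)

lemma free_gradient_add:
  assumes "\<phi> \<in> carrier (free_module (coord_ring n I))" "\<psi> \<in> carrier (free_module (coord_ring n I))"
  shows "gradient_relation n I (\<lambda>k. free_gradient (\<phi> \<oplus>\<^bsub>free_module (coord_ring n I)\<^esub> \<psi>) k -
    (free_gradient \<phi> k + free_gradient \<psi> k))"
proof -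
  let ?supp = "\<lambda>\<phi>. {s. \<phi> s \<noteq> \<zero>\<^bsub>coord_ring n I\<^esub>}"
  \<comment> \<open>A common index set for all three sums; the support of the sum can be smaller
    because of cancellation.\<close>
  let ?S = "?supp \<phi> \<union> ?supp \<psi>"
  have val: "\<phi> s \<in> carrier (coord_ring n I)" "\<psi> s \<in> carrier (coord_ring n I)" for s
    using assms free_module_value[OF coord_ring_algebra] by simp_all
  have fin: "finite ?S" and sub: "?S \<subseteq> carrier (coord_ring n I)"
    using assms by (auto simp: free_module_carrier)
  have eq: "free_gradient \<phi> k = (\<Sum>s\<in>?S. rep (\<phi> s) * partial_deriv k (rep s))"
    "free_gradient \<psi> k = (\<Sum>s\<in>?S. rep (\<psi> s) * partial_deriv k (rep s))" for k
    unfolding free_gradient_def using fin by (intro sum.mono_neutral_left; auto simp: rep_zero)+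
  have "free_gradient \<phi> k + free_gradient \<psi> k =
      (\<Sum>s\<in>?S. (rep (\<phi> s) + rep (\<psi> s)) * partial_deriv k (rep s))" for k
    unfolding eq by (simp add: sum.distrib distrib_right)
  \<comment> \<open>The sum of the two chosen lifts is a lift of the sum of the coefficients, though
    in general not the chosen one.\<close>
  moreover have "gradient_relation n I (\<lambda>k. free_gradient (\<phi> \<oplus>\<^bsub>free_module (coord_ring n I)\<^esub> \<psi>) k -
      (\<Sum>s\<in>?S. (rep (\<phi> s) + rep (\<psi> s)) * partial_deriv k (rep s)))"
    by (rule free_gradient_cong[OF fin sub])
      (auto simp: val rep residue_add poly_ring_closed)
  ultimately show ?thesis by simp
qed

lemma free_gradient_smult:
  assumes p: "p \<in> carrier (poly_ring n)" and \<phi>: "\<phi> \<in> carrier (free_module (coord_ring n I))"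
  shows "gradient_relation n I (\<lambda>k. free_gradient (residue p \<odot>\<^bsub>free_module (coord_ring n I)\<^esub> \<phi>) k -
    p * free_gradient \<phi> k)"
proof -
  let ?S = "{s. \<phi> s \<noteq> \<zero>\<^bsub>coord_ring n I\<^esub>}"
  have val: "\<phi> s \<in> carrier (coord_ring n I)" for s
    using \<phi> free_module_value[OF coord_ring_algebra] by simp
  have fin: "finite ?S" and sub: "?S \<subseteq> carrier (coord_ring n I)"
    using \<phi> by (auto simp: free_module_carrier)
  have "p * free_gradient \<phi> k = (\<Sum>s\<in>?S. (p * rep (\<phi> s)) * partial_deriv k (rep s))" for k
    unfolding free_gradient_def by (simp add: sum_distrib_left mult.assoc)
  moreover have "gradient_relation n I (\<lambda>k. free_gradient (residue p \<odot>\<^bsub>free_module (coord_ring n I)\<^esub> \<phi>) k -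
      (\<Sum>s\<in>?S. (p * rep (\<phi> s)) * partial_deriv k (rep s)))"
    by (rule free_gradient_cong[OF fin sub])
      (use p in \<open>auto simp: val rep residue_mult residue_closed poly_ring_closed\<close>)
  ultimately show ?thesis by simp
qed

lemma free_gradient_dsym:
  assumes "f \<in> carrier (poly_ring n)"
  shows "gradient_relation n I (\<lambda>k. free_gradient (dsym (coord_ring n I) (residue f)) k - partial_deriv k f)"
proof (rule gradient_relation_trans)
  have "gradient_relation n I (\<lambda>k. free_gradient (dsym (coord_ring n I) (residue f)) k -
      (\<Sum>s\<in>{residue f}. 1 * partial_deriv k (rep s)))"
    by (rule free_gradient_cong) (use assms in \<open>auto simp: dsym_def residue_one residue_closed\<close>)
  then show "gradient_relation n I (\<lambda>k. free_gradient (dsym (coord_ring n I) (residue f)) k -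
      partial_deriv k (rep (residue f)))"
    by simp
  show "gradient_relation n I (\<lambda>k. partial_deriv k (rep (residue f)) - partial_deriv k f)"
    using gradient_relation_gradient[OF rep_residue[OF assms]] by (simp add: partial_deriv_diff)
qed

lemma free_gradient_smult_dsym:
  assumes "p \<in> carrier (poly_ring n)" "f \<in> carrier (poly_ring n)"
  shows "gradient_relation n I (\<lambda>k. free_gradient
    (residue p \<odot>\<^bsub>free_module (coord_ring n I)\<^esub> dsym (coord_ring n I) (residue f)) k - p * partial_deriv k f)"
proof (rule gradient_relation_trans)
  show "gradient_relation n I (\<lambda>k. free_gradient
      (residue p \<odot>\<^bsub>free_module (coord_ring n I)\<^esub> dsym (coord_ring n I) (residue f)) k -
      p * free_gradient (dsym (coord_ring n I) (residue f)) k)"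
    using assms by (intro free_gradient_smult dsym_closed[OF coord_ring_algebra] residue_closed)
  show "gradient_relation n I (\<lambda>k. p * free_gradient (dsym (coord_ring n I) (residue f)) k - p * partial_deriv k f)"
    using gradient_relation_mult[OF free_gradient_dsym[OF assms(2)] assms(1)]
    by (simp add: right_diff_distrib)
qed

lemma free_gradient_add_cong:
  assumes "\<phi> \<in> carrier (free_module (coord_ring n I))" "\<psi> \<in> carrier (free_module (coord_ring n I))"
    and "gradient_relation n I (\<lambda>k. free_gradient \<phi> k - u k)" "gradient_relation n I (\<lambda>k. free_gradient \<psi> k - v k)"
  shows "gradient_relation n I (\<lambda>k. free_gradient (\<phi> \<oplus>\<^bsub>free_module (coord_ring n I)\<^esub> \<psi>) k - (u k + v k))"
proof (rule gradient_relation_trans)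
  show "gradient_relation n I (\<lambda>k. free_gradient \<phi> k + free_gradient \<psi> k - (u k + v k))"
    using gradient_relation_add[OF assms(3,4)] by (simp add: algebra_simps)
qed (rule free_gradient_add[OF assms(1,2)])

lemma free_gradient_minus_cong:
  assumes \<phi>: "\<phi> \<in> carrier (free_module (coord_ring n I))" and \<psi>: "\<psi> \<in> carrier (free_module (coord_ring n I))"
    and u: "gradient_relation n I (\<lambda>k. free_gradient \<phi> k - u k)"
    and v: "gradient_relation n I (\<lambda>k. free_gradient \<psi> k - v k)"
  shows "gradient_relation n I (\<lambda>k. free_gradient (\<phi> \<ominus>\<^bsub>free_module (coord_ring n I)\<^esub> \<psi>) k - (u k - v k))"
proof -
  let ?d = "\<phi> \<ominus>\<^bsub>free_module (coord_ring n I)\<^esub> \<psi>"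
  have d: "?d \<in> carrier (free_module (coord_ring n I))"
    using \<phi> \<psi> by (rule F.M.minus_closed)
  \<comment> \<open>Subtraction is reduced to the known additivity by writing \<phi> as the
    difference plus \<psi>.\<close>
  have "?d \<oplus>\<^bsub>free_module (coord_ring n I)\<^esub> \<psi> = \<phi>"
    unfolding a_minus_def using \<phi> \<psi> F.M.add.inv_solve_right' F.M.a_inv_closed F.M.a_assoc F.M.l_neg F.M.r_zero
    by presburger
  then have "gradient_relation n I (\<lambda>k. free_gradient \<phi> k - (free_gradient ?d k + free_gradient \<psi> k))"
    using free_gradient_add[OF d \<psi>] by simp
  from gradient_relation_add[OF gradient_relation_add[OF gradient_relation_uminus[OF this] u]
      gradient_relation_uminus[OF v]]
  show ?thesis by (simp add: algebra_simps)
qed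

text \<open>The three families express that d is additive, linear over the base field and satisfies
  the Leibniz rule. The gradient of polynomials has the same properties, so the tuple attached to a
  relation is congruent to 0.\<close>

lemma free_gradient_relations:
  assumes "\<phi> \<in> kaehler_relations (coord_ring n I)"
  shows "gradient_relation n I (free_gradient \<phi>)"
proof -
  let ?A = "coord_ring n I" and ?F = "free_module (coord_ring n I)"
  let ?d = "\<lambda>f. dsym ?A (residue f)"
  have d: "?d f \<in> carrier ?F" if "f \<in> carrier (poly_ring n)" for f
    using that by (intro dsym_closed[OF coord_ring_algebra] residue_closed)
  have rd: "residue p \<odot>\<^bsub>?F\<^esub> ?d f \<in> carrier ?F"
    if "p \<in> carrier (poly_ring n)" "f \<in> carrier (poly_ring n)" for p f
    using that by (intro F.smult_closed d residue_closed)
  have ex: "\<exists>f\<in>carrier (poly_ring n). x = residue f" if "x \<in> carrier ?A" for x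
    using that unfolding coord_ring_carrier by (rule imageE) (rule bexI)
  consider (add) s t where "s \<in> carrier ?A" "t \<in> carrier ?A"
      "\<phi> = dsym ?A (s \<oplus>\<^bsub>?A\<^esub> t) \<ominus>\<^bsub>?F\<^esub> (dsym ?A s \<oplus>\<^bsub>?F\<^esub> dsym ?A t)"
    | (scalar) c s where "s \<in> carrier ?A"
      "\<phi> = dsym ?A (c \<odot>\<^bsub>?A\<^esub> s) \<ominus>\<^bsub>?F\<^esub> ((c \<odot>\<^bsub>?A\<^esub> \<one>\<^bsub>?A\<^esub>) \<odot>\<^bsub>?F\<^esub> dsym ?A s)"
    | (mult) s t where "s \<in> carrier ?A" "t \<in> carrier ?A"
      "\<phi> = dsym ?A (s \<otimes>\<^bsub>?A\<^esub> t) \<ominus>\<^bsub>?F\<^esub> (s \<odot>\<^bsub>?F\<^esub> dsym ?A t \<oplus>\<^bsub>?F\<^esub> t \<odot>\<^bsub>?F\<^esub> dsym ?A s)"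
    using assms unfolding kaehler_relations_def Let_def by (elim UnE CollectE exE conjE) metis+
  then show ?thesis
  proof cases
    case add
    then obtain f g where fg: "f \<in> carrier (poly_ring n)" "g \<in> carrier (poly_ring n)"
      and st: "s = residue f" "t = residue g" using ex by metis
    have \<phi>: "\<phi> = ?d (f + g) \<ominus>\<^bsub>?F\<^esub> (?d f \<oplus>\<^bsub>?F\<^esub> ?d g)"
      unfolding add(3) st residue_add[OF fg] ..
    have "gradient_relation n I (\<lambda>k. free_gradient \<phi> k -
        (partial_deriv k (f + g) - (partial_deriv k f + partial_deriv k g)))"
      unfolding \<phi>
      by (intro free_gradient_minus_cong free_gradient_add_cong free_gradient_dsym d F.M.add.m_closed
          poly_ring_closed fg)
    then show ?thesis by (simp add: partial_deriv_add)
  next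
    case scalar
    then obtain f where f: "f \<in> carrier (poly_ring n)" and s: "s = residue f" using ex by metis
    let ?c = "Poly_Mapping.single 0 c"
    have \<phi>: "\<phi> = ?d (?c * f) \<ominus>\<^bsub>?F\<^esub> (residue ?c \<odot>\<^bsub>?F\<^esub> ?d f)"
      unfolding scalar(2) s residue_smult[OF f] residue_const ..
    have "gradient_relation n I (\<lambda>k. free_gradient \<phi> k - (partial_deriv k (?c * f) - ?c * partial_deriv k f))"
      unfolding \<phi>
      by (intro free_gradient_minus_cong free_gradient_dsym free_gradient_smult_dsym d rd
          poly_ring_closed poly_ring_consts f)
    then show ?thesis by (simp add: partial_deriv_mult)
  next
    case mult
    then obtain f g where fg: "f \<in> carrier (poly_ring n)" "g \<in> carrier (poly_ring n)"
      and st: "s = residue f" "t = residue g" using ex by metis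
    have \<phi>: "\<phi> = ?d (f * g) \<ominus>\<^bsub>?F\<^esub> (residue f \<odot>\<^bsub>?F\<^esub> ?d g \<oplus>\<^bsub>?F\<^esub> residue g \<odot>\<^bsub>?F\<^esub> ?d f)"
      unfolding mult(3) st residue_mult[OF fg] ..
    have "gradient_relation n I (\<lambda>k. free_gradient \<phi> k -
        (partial_deriv k (f * g) - (f * partial_deriv k g + g * partial_deriv k f)))"
      unfolding \<phi>
      by (intro free_gradient_minus_cong free_gradient_add_cong free_gradient_dsym free_gradient_smult_dsym
          d rd F.M.add.m_closed poly_ring_closed fg)
    then show ?thesis by (simp add: partial_deriv_mult)
  qed
qed

text \<open>The elements whose tuple is a gradient relation form a submodule. It contains the
  generating relations, hence their span.\<close>

lemma free_gradient_kaehler_submodule: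
  assumes "\<phi> \<in> kaehler_submodule (coord_ring n I)"
  shows "gradient_relation n I (free_gradient \<phi>)"
proof -
  let ?F = "free_module (coord_ring n I)"
  let ?N = "{\<phi> \<in> carrier ?F. gradient_relation n I (free_gradient \<phi>)}"
  have "submodule (coord_ring n I) ?N ?F"
  proof (rule submodule.intro)
    show "module (coord_ring n I) ?F" by (rule free_module_module[OF coord_ring_algebra])
    show "?N \<subseteq> carrier ?F" by (rule Collect_restrict)
    show "\<phi> \<oplus>\<^bsub>?F\<^esub> \<psi> \<in> ?N" if "\<phi> \<in> ?N" "\<psi> \<in> ?N" for \<phi> \<psi>
      using that free_gradient_add_cong[of \<phi> \<psi> "\<lambda>k. 0" "\<lambda>k. 0"] F.M.add.m_closed[of \<phi> \<psi>]
      by (simp del: free_module_simps)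
    show "\<zero>\<^bsub>?F\<^esub> \<in> ?N"
      using F.M.zero_closed by (simp add: free_gradient_def gradient_relation_ideal ideal_zero)
    show "r \<odot>\<^bsub>?F\<^esub> \<phi> \<in> ?N" if r: "r \<in> carrier (coord_ring n I)" and "\<phi> \<in> ?N" for r \<phi>
    proof -
      obtain p where p: "p \<in> carrier (poly_ring n)" "r = residue p"
        using r unfolding coord_ring_carrier by (rule imageE)
      have \<phi>: "\<phi> \<in> carrier ?F" "gradient_relation n I (free_gradient \<phi>)" using that by simp_all
      from gradient_relation_add[OF free_gradient_smult[OF p(1) \<phi>(1)] gradient_relation_mult[OF \<phi>(2) p(1)]]
      show ?thesis
        using F.smult_closed[OF r \<phi>(1)] by (simp add: p(2) del: free_module_simps)
    qed
  qed
  moreover have "kaehler_relations (coord_ring n I) \<subseteq> ?N"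
    using kaehler_relations_subset[OF coord_ring_algebra] free_gradient_relations by (simp add: subset_iff)
  ultimately have "kaehler_submodule (coord_ring n I) \<subseteq> ?N"
    unfolding kaehler_submodule_def by (intro F.span_is_subset)
  then show ?thesis using assms by auto
qed

text \<open>Exactness of the conormal presentation: the kernel consists of gradients of I together
  with tuples over I. If the differential vanishes, it is lifted to the free module on all ds; the
  lift is a combination of defining relations, and \<open>free_gradient\<close> recovers u from it
  up to a gradient relation. Conversely, the gradient of f in I represents df = d0 = 0.\<close>

lemma diff_form_eq_zero_iff:
  assumes u: "\<And>k. k \<le> n \<Longrightarrow> u k \<in> carrier (poly_ring n)"
  shows "diff_form u = \<zero>\<^bsub>kaehler_module (coord_ring n I)\<^esub> \<longleftrightarrow> gradient_relation n I u"
proof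
  let ?A = "coord_ring n I" and ?F = "free_module (coord_ring n I)"
  let ?t = "\<lambda>k. residue (u k) \<odot>\<^bsub>?F\<^esub> dsym ?A (residue (indet k))"
  assume zero: "diff_form u = \<zero>\<^bsub>kaehler_module ?A\<^esub>"
  have t: "?t k \<in> carrier ?F" if "k \<le> n" for k
    using that by (intro F.smult_closed dsym_closed[OF coord_ring_algebra] residue_closed u indet_closed)
  have sum_closed: "(\<Oplus>\<^bsub>?F\<^esub>k\<in>S. ?t k) \<in> carrier ?F" if "S \<subseteq> {..n}" for S
    using that t by (intro F.M.finsum_closed Pi_I) auto
  have q: "(\<lambda>x. kaehler_submodule ?A +>\<^bsub>?F\<^esub> x) \<in> LinearCombinations.module_hom ?A ?F (kaehler_module ?A)"
    unfolding kaehler_module_def by (rule quot_module_hom[OF kaehler_submodule[OF coord_ring_algebra]])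
  interpret q: mod_hom ?A ?F "kaehler_module ?A" "\<lambda>x. kaehler_submodule ?A +>\<^bsub>?F\<^esub> x"
    by unfold_locales (rule q)
  have "diff_form u = kaehler_submodule ?A +>\<^bsub>?F\<^esub> (\<Oplus>\<^bsub>?F\<^esub>k\<in>{..n}. ?t k)"
  proof -
    have t': "kaehler_submodule ?A +>\<^bsub>?F\<^esub> ?t k \<in> carrier (kaehler_module ?A)" if "k \<le> n" for k
      using q.f_im t[OF that] by blast
    have "kaehler_submodule ?A +>\<^bsub>?F\<^esub> (\<Oplus>\<^bsub>?F\<^esub>k\<in>S. ?t k) =
        (\<Oplus>\<^bsub>kaehler_module ?A\<^esub>k\<in>S. kaehler_submodule ?A +>\<^bsub>?F\<^esub> ?t k)" if "finite S" "S \<subseteq> {..n}" for S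
      using that
    proof (induction S rule: finite_induct)
      case empty
      then show ?case using q.f0_is_0 by simp
    next
      case (insert k S)
      then have "(\<Oplus>\<^bsub>?F\<^esub>k\<in>insert k S. ?t k) = ?t k \<oplus>\<^bsub>?F\<^esub> (\<Oplus>\<^bsub>?F\<^esub>k\<in>S. ?t k)"
        using t by (intro F.M.finsum_insert Pi_I) auto
      moreover have "(\<Oplus>\<^bsub>kaehler_module ?A\<^esub>k\<in>insert k S. kaehler_submodule ?A +>\<^bsub>?F\<^esub> ?t k) =
          (kaehler_submodule ?A +>\<^bsub>?F\<^esub> ?t k) \<oplus>\<^bsub>kaehler_module ?A\<^esub>
          (\<Oplus>\<^bsub>kaehler_module ?A\<^esub>k\<in>S. kaehler_submodule ?A +>\<^bsub>?F\<^esub> ?t k)"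
        using insert t' by (intro \<Omega>.M.finsum_insert Pi_I) auto
      ultimately show ?case
        using insert t sum_closed[of S] by (simp del: free_module_simps)
    qed
    then have "kaehler_submodule ?A +>\<^bsub>?F\<^esub> (\<Oplus>\<^bsub>?F\<^esub>k\<in>{..n}. ?t k) =
        (\<Oplus>\<^bsub>kaehler_module ?A\<^esub>k\<in>{..n}. kaehler_submodule ?A +>\<^bsub>?F\<^esub> ?t k)"
      by blast
    also have "\<dots> = diff_form u"
      unfolding diff_form_def
      by (intro \<Omega>.M.finsum_cong' Pi_I refl diff_term_closed residue_closed u indet_closed
          kaehler_d_smult[OF coord_ring_algebra, symmetric]) auto
    finally show ?thesis ..
  qed
  moreover have "(\<Oplus>\<^bsub>?F\<^esub>k\<in>{..n}. ?t k) \<in>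
      kaehler_submodule ?A +>\<^bsub>?F\<^esub> (\<Oplus>\<^bsub>?F\<^esub>k\<in>{..n}. ?t k)"
    using submodule_abelian_subgroup[OF kaehler_submodule[OF coord_ring_algebra]] sum_closed[OF subset_refl]
    by (rule abelian_subgroup.a_rcos_self)
  \<comment> \<open>The zero of the quotient is the submodule itself as a set, so an element whose
    coset is zero lies in the submodule.\<close>
  ultimately have "(\<Oplus>\<^bsub>?F\<^esub>k\<in>{..n}. ?t k) \<in> kaehler_submodule ?A"
    using zero by (simp add: kaehler_module_def)
  then have rel: "gradient_relation n I (free_gradient (\<Oplus>\<^bsub>?F\<^esub>k\<in>{..n}. ?t k))"
    by (rule free_gradient_kaehler_submodule)
  \<comment> \<open>The tuple of the lift is computed summand by summand. For the full index set the
    resulting sum is u_l at position l, since the derivative of X_k by X_l is 1 or 0.\<close>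
  have "gradient_relation n I (\<lambda>l. free_gradient (\<Oplus>\<^bsub>?F\<^esub>k\<in>S. ?t k) l -
      (\<Sum>k\<in>S. u k * partial_deriv l (indet k)))" if "finite S" "S \<subseteq> {..n}" for S
    using that
  proof (induction S rule: finite_induct)
    case empty
    then show ?case
      by (simp add: free_gradient_def gradient_relation_ideal ideal_zero)
  next
    case (insert k S)
    then have "gradient_relation n I (\<lambda>l. free_gradient (?t k \<oplus>\<^bsub>?F\<^esub> (\<Oplus>\<^bsub>?F\<^esub>k\<in>S. ?t k)) l -
        (u k * partial_deriv l (indet k) + (\<Sum>k\<in>S. u k * partial_deriv l (indet k))))"
      by (intro free_gradient_add_cong free_gradient_smult_dsym t sum_closed u indet_closed) auto
    moreover have "(\<Oplus>\<^bsub>?F\<^esub>k\<in>insert k S. ?t k) = ?t k \<oplus>\<^bsub>?F\<^esub> (\<Oplus>\<^bsub>?F\<^esub>k\<in>S. ?t k)"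
      using insert t by (intro F.M.finsum_insert Pi_I) auto
    ultimately show ?case
      using insert by (simp del: free_module_simps)
  qed
  from this[of "{..n}"]
  have "gradient_relation n I (\<lambda>l. free_gradient (\<Oplus>\<^bsub>?F\<^esub>k\<in>{..n}. ?t k) l -
      (\<Sum>k\<le>n. u k * partial_deriv l (indet k)))" by simp
  from gradient_relation_add[OF gradient_relation_uminus[OF this] rel]
  have "gradient_relation n I (\<lambda>l. \<Sum>k\<le>n. u k * partial_deriv l (indet k))" by simp
  moreover have "(\<Sum>k\<le>n. u k * partial_deriv l (indet k)) = u l" if "l \<le> n" for l
    using that by (simp add: partial_deriv_indet if_distrib sum.delta cong: if_cong)
  ultimately show "gradient_relation n I u"
    unfolding gradient_relation_def by simp
next
  assume "gradient_relation n I u"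
  then obtain f where f: "f \<in> I" "\<And>k. k \<le> n \<Longrightarrow> u k - partial_deriv k f \<in> I"
    unfolding gradient_relation_def by blast
  have P: "f \<in> carrier (poly_ring n)" using f(1) by (rule ideal_subset)
  have "diff_form u = diff_form (\<lambda>k. partial_deriv k f)"
    using u f(2) P by (intro diff_form_cong partial_deriv_closed)
  also have "\<dots> = diff 0"
    using diff_expand[OF P] residue_eq_zero_iff[OF P] f(1) by (simp add: residue_zero)
  also have "\<dots> = \<zero>\<^bsub>kaehler_module (coord_ring n I)\<^esub>"
    using diff_const[of 0] by simp
  finally show "diff_form u = \<zero>\<^bsub>kaehler_module (coord_ring n I)\<^esub>" .
qed

end

section \<open>Hilbert functions\<close>

text \<open>The last index m of a tuple is separate from n: m = 0 gives a copy of the forms of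
  degree d, which is the source for the coordinate ring, and m = n gives the coefficients of dX_0,
  ..., dX_n. Entries beyond m are set to 0 so that a tuple is determined by finitely many
  forms.\<close>

definition form_tuples :: "nat \<Rightarrow> nat \<Rightarrow> nat \<Rightarrow> ('k::field, nat \<Rightarrow> 'k polynomial) module" where
  "form_tuples n m d =
     \<lparr>carrier = {u. (\<forall>k\<le>m. u k \<in> forms n d) \<and> (\<forall>k>m. u k = 0)},
      mult = undefined, one = undefined,
      zero = (\<lambda>k. 0), add = (\<lambda>u v k. u k + v k),
      smult = (\<lambda>c u k. Poly_Mapping.single 0 c * u k)\<rparr>"

lemma form_tuples_simps [simp]:
  "zero (form_tuples n m d) = (\<lambda>k. 0)" "add (form_tuples n m d) = (\<lambda>u v k. u k + v k)"
  "smult (form_tuples n m d) = (\<lambda>c u k. Poly_Mapping.single 0 c * u k)"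
  "carrier (form_tuples n m d) = {u. (\<forall>k\<le>m. u k \<in> forms n d) \<and> (\<forall>k>m. u k = 0)}"
  by (simp_all add: form_tuples_def)

lemma form_tuples_vectorspace: "vectorspace class_ring (form_tuples n m d :: ('k::field, _) module)"
proof -
  let ?V = "form_tuples n m d :: ('k, nat \<Rightarrow> 'k polynomial) module"
  have "module class_ring ?V"
  proof (rule moduleI)
    show "abelian_group ?V"
    proof (rule abelian_groupI)
      show "\<exists>v\<in>carrier ?V. v \<oplus>\<^bsub>?V\<^esub> u = \<zero>\<^bsub>?V\<^esub>" if "u \<in> carrier ?V" for u
        using that by (intro bexI[of _ "\<lambda>k. - u k"]) (simp_all add: forms_uminus)
    qed (simp_all add: forms_add add_ac)
    show "(a \<otimes>\<^bsub>class_ring\<^esub> b) \<odot>\<^bsub>?V\<^esub> u = a \<odot>\<^bsub>?V\<^esub> (b \<odot>\<^bsub>?V\<^esub> u)" for a b :: 'k and u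
      by (simp add: mult_single flip: mult.assoc)
  qed (simp_all add: class_cring.cring_axioms forms_smult single_add distrib_left distrib_right)
  then show ?thesis
    by (simp add: vectorspace_def class_field)
qed

lemma form_tuples_fin_dim:
  "vectorspace.fin_dim class_ring (form_tuples n m d :: ('k::field, _) module)"
proof -
  let ?V = "form_tuples n m d :: ('k, nat \<Rightarrow> 'k polynomial) module"
  interpret V: vectorspace class_ring ?V by (rule form_tuples_vectorspace)
  let ?M = "{x. Poly_Mapping.keys x \<subseteq> {..n} \<and> monom_degree x = d}"
  \<comment> \<open>The tuple with the monomial x at position k and 0 elsewhere; these form the
    spanning family.\<close>
  define e :: "nat \<times> monom \<Rightarrow> nat \<Rightarrow> 'k polynomial" where
    "e = (\<lambda>(k, x) l. if l = k then Poly_Mapping.single x 1 else 0)"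
  let ?B = "e ` ({..m} \<times> ?M)"
  have B: "?B \<subseteq> carrier ?V"
    by (auto simp: e_def forms_def carrier_poly_ring split: if_splits)
  interpret S: submodule class_ring "V.span ?B" ?V
    using B by (rule V.span_is_submodule)
  have comb: "(\<lambda>l. \<Sum>p\<in>P. Poly_Mapping.single 0 (c p) * e p l) \<in> V.span ?B"
    if "finite P" "P \<subseteq> {..m} \<times> ?M" for P and c :: "nat \<times> monom \<Rightarrow> 'k"
    using that
  proof (induction P rule: finite_induct)
    case empty
    then show ?case using S.zero_closed by simp
  next
    case (insert p P)
    then have "e p \<in> V.span ?B"
      using V.in_own_span[OF B] by blast
    then have "c p \<odot>\<^bsub>?V\<^esub> e p \<in> V.span ?B"
      by (intro S.smult_closed) simp_all
    with insert show ?case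
      using S.m_closed[of "c p \<odot>\<^bsub>?V\<^esub> e p"] by simp
  qed
  have "u \<in> V.span ?B" if "u \<in> carrier ?V" for u
  proof -
    have "u l = (\<Sum>p\<in>{..m} \<times> ?M. Poly_Mapping.single 0 (Poly_Mapping.lookup (u (fst p)) (snd p)) * e p l)" for l
    proof -
      have "(\<Sum>p\<in>{..m} \<times> ?M. Poly_Mapping.single 0 (Poly_Mapping.lookup (u (fst p)) (snd p)) * e p l) =
          (\<Sum>(k, x)\<in>{..m} \<times> ?M. if l = k then Poly_Mapping.single x (Poly_Mapping.lookup (u k) x) else 0)"
        by (rule sum.cong) (auto simp: e_def mult_single)
      also have "\<dots> = (\<Sum>k\<le>m. if l = k then \<Sum>x\<in>?M. Poly_Mapping.single x (Poly_Mapping.lookup (u k) x) else 0)"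
        unfolding sum.cartesian_product[symmetric] by (rule sum.cong) auto
      also have "\<dots> = (if l \<le> m then \<Sum>x\<in>?M. Poly_Mapping.single x (Poly_Mapping.lookup (u l) x) else 0)"
        by (simp add: sum.delta)
      also have "\<dots> = u l"
      proof (cases "l \<le> m")
        case True
        then have "u l \<in> forms n d" using that by simp
        then have "(\<Sum>x\<in>?M. Poly_Mapping.single x (Poly_Mapping.lookup (u l) x)) =
            (\<Sum>x\<in>Poly_Mapping.keys (u l). Poly_Mapping.single x (Poly_Mapping.lookup (u l) x))"
          by (intro sum.mono_neutral_right finite_monoms)
            (auto simp: forms_def carrier_poly_ring in_keys_iff)
        with True show ?thesis by (simp flip: poly_mapping_sum_singles)
      qed (use that in simp)
      finally show ?thesis ..
    qed
    then have "u = (\<lambda>l. \<Sum>p\<in>{..m} \<times> ?M.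
        Poly_Mapping.single 0 (Poly_Mapping.lookup (u (fst p)) (snd p)) * e p l)"
      by (rule ext)
    also have "\<dots> \<in> V.span ?B"
      by (rule comb) (simp_all add: finite_monoms)
    finally show ?thesis .
  qed
  then have "V.span ?B = carrier ?V"
    using V.span_is_subset2[OF B] by (intro equalityI[OF _ subsetI])
  then show ?thesis
    unfolding V.fin_dim_def using B by (intro exI[of _ ?B] conjI finite_imageI finite_cartesian_product finite_monoms) simp_all
qed

section \<open>The coordinate ring in a fixed degree\<close>

lemma form_tuples_0_residue:
  "(\<lambda>u. I +>\<^bsub>poly_ring n\<^esub> u 0) ` carrier (form_tuples n 0 d) = coord_component n I d"
proof -
  have "(\<lambda>u. u 0) ` carrier (form_tuples n 0 d) = (forms n d :: 'a polynomial set)"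
    by (auto intro!: image_eqI[of _ _ "\<lambda>k. if k = 0 then f else 0" for f])
  from arg_cong[OF this, of "\<lambda>X. (\<lambda>f. I +>\<^bsub>poly_ring n\<^esub> f) ` X"] show ?thesis
    unfolding coord_component_def by (simp only: image_image)
qed

lemma residue_module_hom:
  assumes "ideal I (poly_ring n)"
  shows "(\<lambda>u. I +>\<^bsub>poly_ring n\<^esub> u 0) \<in> LinearCombinations.module_hom class_ring (form_tuples n 0 d) (coord_ring n I)"
  unfolding LinearCombinations.module_hom_def
  by (auto simp: residue_closed[OF assms] residue_add[OF assms] residue_smult[OF assms] forms_subset)

text \<open>The degree-d part of P/I is the image of the forms of degree d, with the forms lying in
  I as kernel.\<close>

lemma HF_eq_iff:
  assumes I: "ideal I (poly_ring n)" and J: "ideal J (poly_ring n)" and "I \<subseteq> J"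
  shows "HF n I d = HF n J d \<longleftrightarrow> I \<inter> forms n d = J \<inter> forms n d"
proof -
  let ?V = "form_tuples n 0 d"
  have ker: "{u \<in> carrier ?V. I +>\<^bsub>poly_ring n\<^esub> u 0 = \<zero>\<^bsub>coord_ring n I\<^esub>} = {u \<in> carrier ?V. u 0 \<in> I}"
    if "ideal I (poly_ring n)" for I :: "'a polynomial set"
    by (rule Collect_cong, rule conj_cong[OF refl], rule residue_eq_zero_iff[OF that])
      (auto intro: forms_subset)
  have "HF n I d = HF n J d \<longleftrightarrow> {u \<in> carrier ?V. u 0 \<in> I} = {u \<in> carrier ?V. u 0 \<in> J}"
    unfolding HF_def hilbert_function_def form_tuples_0_residue[symmetric] ker[OF I, symmetric] ker[OF J, symmetric]
    using \<open>I \<subseteq> J\<close>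
    by (intro dim_image_eq_iff_kernel_eq form_tuples_vectorspace form_tuples_fin_dim
        coord_ring_module residue_module_hom I J) (auto simp: ker[OF I] ker[OF J] simp del: form_tuples_simps)
  also have "\<dots> \<longleftrightarrow> I \<inter> forms n d = J \<inter> forms n d"
  proof
    assume eq: "{u \<in> carrier ?V. u 0 \<in> I} = {u \<in> carrier ?V. u 0 \<in> J}"
    have "f \<in> I" if "f \<in> J" "f \<in> forms n d" for f
    proof -
      have "(\<lambda>k. if k = 0 then f else 0) \<in> {u \<in> carrier ?V. u 0 \<in> J}" using that by simp
      then show ?thesis unfolding eq[symmetric] by simp
    qed
    with \<open>I \<subseteq> J\<close> show "I \<inter> forms n d = J \<inter> forms n d" by blast
  next
    assume "I \<inter> forms n d = J \<inter> forms n d"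
    then have "f \<in> I \<longleftrightarrow> f \<in> J" if "f \<in> forms n d" for f using that by blast
    then show "{u \<in> carrier ?V. u 0 \<in> I} = {u \<in> carrier ?V. u 0 \<in> J}" by auto
  qed
  finally show ?thesis .
qed

section \<open>Differentials in a fixed degree\<close>

lemma diff_form_module_hom:
  assumes I: "ideal I (poly_ring n)"
  shows "diff_form n I \<in> LinearCombinations.module_hom class_ring (form_tuples n n d)
    (restrict_scalars (coord_ring n I) (kaehler_module (coord_ring n I)))"
proof -
  have sub: "u k \<in> carrier (poly_ring n)" if "u \<in> carrier (form_tuples n n d)" "k \<le> n" for u and k
    using that forms_subset by auto
  show ?thesis
    unfolding LinearCombinations.module_hom_def mem_Collect_eq
  proof (intro conjI allI impI; (elim conjE)?)
    show "diff_form n I \<in> carrier (form_tuples n n d) \<rightarrow>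
        carrier (restrict_scalars (coord_ring n I) (kaehler_module (coord_ring n I)))"
      by (intro Pi_I) (simp add: diff_form_closed[OF I] sub del: form_tuples_simps)
    show "diff_form n I (u \<oplus>\<^bsub>form_tuples n n d\<^esub> v) = diff_form n I u
        \<oplus>\<^bsub>restrict_scalars (coord_ring n I) (kaehler_module (coord_ring n I))\<^esub> diff_form n I v"
      if "u \<in> carrier (form_tuples n n d)" "v \<in> carrier (form_tuples n n d)" for u v
      using diff_form_add[OF I, of u v] sub[OF that(1)] sub[OF that(2)] by (simp del: form_tuples_simps(4))
    show "diff_form n I (c \<odot>\<^bsub>form_tuples n n d\<^esub> u) =
        c \<odot>\<^bsub>restrict_scalars (coord_ring n I) (kaehler_module (coord_ring n I))\<^esub> diff_form n I u"
      if "u \<in> carrier (form_tuples n n d)" for c u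
      using diff_form_smult[OF I poly_ring_consts(3), of u c] sub[OF that]
      by (simp add: residue_const[OF I] del: form_tuples_simps(4))
  qed
qed

text \<open>The coefficients have degree one less than the differential because dX_k has degree 1. A
  generator g df expands into the dX_k with coefficients g (df/dX_k) of degree d, and conversely
  each u_k dX_k is a generator of degree d + 1.\<close>

lemma kaehler_component_eq:
  assumes I: "ideal I (poly_ring n)"
  shows "kaehler_component (coord_ring n I) (coord_component n I) (Suc d) =
    diff_form n I ` carrier (form_tuples n n d)"
proof -
  let ?A = "coord_ring n I"
  let ?\<Omega> = "kaehler_module ?A"
  let ?W = "restrict_scalars ?A ?\<Omega>"
  let ?V = "form_tuples n n d :: ('a, nat \<Rightarrow> 'a polynomial) module"
  let ?G = "{r \<odot>\<^bsub>?\<Omega>\<^esub> kaehler_d ?A s | r s.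
    \<exists>a b. a + b = Suc d \<and> r \<in> coord_component n I a \<and> s \<in> coord_component n I b}"
  have alg: "algebra class_ring ?A" by (rule coord_ring_algebra[OF I])
  interpret \<Omega>: Module.module ?A ?\<Omega> using alg by (rule kaehler_module_module)
  have W: "module class_ring ?W"
    using alg \<Omega>.module_axioms by (intro restrict_scalars_module) (simp add: kaehler_module_module)
  interpret W: Module.module class_ring ?W by (rule W)
  interpret h: mod_hom class_ring ?V ?W "diff_form n I"
    using vectorspace.axioms(1)[OF form_tuples_vectorspace] W diff_form_module_hom[OF I]
    by (intro mod_hom.intro mod_hom_axioms.intro)
  have G: "?G \<subseteq> diff_form n I ` carrier ?V"
  proof
    fix x assume "x \<in> ?G"
    then obtain r s a b where ab: "a + b = Suc d" and "r \<in> coord_component n I a" "s \<in> coord_component n I b"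
      and x: "x = r \<odot>\<^bsub>?\<Omega>\<^esub> kaehler_d ?A s"
      by (elim CollectE exE conjE)
    then obtain g f where g: "g \<in> forms n a" and f: "f \<in> forms n b"
      and rs: "r = I +>\<^bsub>poly_ring n\<^esub> g" "s = I +>\<^bsub>poly_ring n\<^esub> f"
      unfolding coord_component_def by (elim imageE)
    note gf = forms_subset[OF g] forms_subset[OF f]
    \<comment> \<open>Cut off beyond n to lie in the space of tuples; the value of
      \<open>diff_form\<close> depends only on the entries up to n.\<close>
    let ?u = "\<lambda>k. if k \<le> n then g * partial_deriv k f else 0"
    have "x = diff_form n I (\<lambda>k. g * partial_deriv k f)"
      unfolding x rs diff_expand[OF I gf(2)] by (rule diff_form_smult[OF I, symmetric]) (simp_all add: gf partial_deriv_closed)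
    also have "\<dots> = diff_form n I ?u"
      by (rule diff_form_cong[OF I]) (simp_all add: gf partial_deriv_closed poly_ring_closed ideal_zero[OF I])
    finally have "x = diff_form n I ?u" .
    \<comment> \<open>If b = 0, then f is constant and the product is 0, which counts as a form of
      every degree; otherwise the degree is a + (b - 1) = d.\<close>
    moreover have "g * partial_deriv k f \<in> forms n d" for k
    proof (cases b)
      case 0
      then show ?thesis using partial_deriv_forms_0[of f n k] f by simp
    next
      case (Suc b')
      then have "d = a + b'" using ab by simp
      then show ?thesis using forms_mult[OF g partial_deriv_in_forms] f Suc by simp
    qed
    ultimately show "x \<in> diff_form n I ` carrier ?V" by (intro image_eqI[of x _ ?u]) simp_all
  qed
  have GW: "?G \<subseteq> carrier ?W"
    by (rule subset_trans[OF G image_subsetI]) (rule h.f_im)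
  have "W.span ?G \<subseteq> diff_form n I ` carrier ?V"
    using W.span_is_subset[OF G] h.im_is_submodule by (simp add: h.im_def)
  moreover have "diff_form n I ` carrier ?V \<subseteq> W.span ?G"
  proof
    fix x assume "x \<in> diff_form n I ` carrier ?V"
    then obtain u where u: "u \<in> carrier ?V" and x: "x = diff_form n I u" by (elim imageE)
    interpret S: submodule class_ring "W.span ?G" ?W using GW by (rule W.span_is_submodule)
    let ?t = "\<lambda>k. (I +>\<^bsub>poly_ring n\<^esub> u k) \<odot>\<^bsub>?\<Omega>\<^esub> kaehler_d ?A (I +>\<^bsub>poly_ring n\<^esub> indet k)"
    have t: "?t k \<in> W.span ?G" if "k \<le> n" for k
    proof -
      have "u k \<in> forms n d" "indet k \<in> forms n 1"
        using u that indet_in_forms by auto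
      then have "?t k \<in> ?G"
        unfolding coord_component_def
        by (intro CollectI exI[of _ "I +>\<^bsub>poly_ring n\<^esub> u k"] exI[of _ "I +>\<^bsub>poly_ring n\<^esub> indet k"]
            exI[of _ d] exI[of _ 1] conjI imageI refl) simp_all
      with W.in_own_span[OF GW] show ?thesis by (rule subsetD)
    qed
    have tW: "?t k \<in> carrier ?\<Omega>" if "k \<le> n" for k
      using subsetD[OF S.subset t[OF that]] by simp
    have "(\<Oplus>\<^bsub>?\<Omega>\<^esub>k\<in>T. ?t k) \<in> W.span ?G" if "finite T" "T \<subseteq> {..n}" for T
      using that
    proof (induction T rule: finite_induct)
      case empty
      then show ?case using S.zero_closed by simp
    next
      case (insert k T)
      have "(\<Oplus>\<^bsub>?\<Omega>\<^esub>k\<in>insert k T. ?t k) = ?t k \<oplus>\<^bsub>?\<Omega>\<^esub> (\<Oplus>\<^bsub>?\<Omega>\<^esub>k\<in>T. ?t k)"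
        using insert tW by (intro \<Omega>.M.finsum_insert Pi_I) (simp_all add: subset_iff)
      also have "\<dots> \<in> W.span ?G"
        using S.m_closed[OF t, of k "\<Oplus>\<^bsub>?\<Omega>\<^esub>k\<in>T. ?t k"] insert by (simp add: subset_iff)
      finally show ?case .
    qed
    from this[of "{..n}"] show "x \<in> W.span ?G"
      unfolding x diff_form_def[OF I] by simp
  qed
  ultimately show ?thesis
    unfolding kaehler_component_def by (rule equalityI)
qed

text \<open>The kernels in question are the gradient relations among tuples of degree d. Relations
  for I are always relations for J, so only the reverse implication remains as a condition.\<close>

lemma HF_Omega_eq_iff:
  assumes I: "ideal I (poly_ring n)" and J: "ideal J (poly_ring n)" and "I \<subseteq> J"
  shows "HF_Omega n I (Suc d) = HF_Omega n J (Suc d) \<longleftrightarrow>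
    (\<forall>u\<in>carrier (form_tuples n n d). gradient_relation n J u \<longrightarrow> gradient_relation n I u)"
proof -
  let ?V = "form_tuples n n d"
  let ?W = "\<lambda>I. restrict_scalars (coord_ring n I) (kaehler_module (coord_ring n I))"
  have W: "module class_ring (?W I)" if "ideal I (poly_ring n)" for I :: "'a polynomial set"
    using coord_ring_algebra[OF that] kaehler_module_module[OF coord_ring_algebra[OF that]]
    by (rule restrict_scalars_module)
  have ker: "{u \<in> carrier ?V. diff_form n I u = \<zero>\<^bsub>?W I\<^esub>} = {u \<in> carrier ?V. gradient_relation n I u}"
    if "ideal I (poly_ring n)" for I :: "'a polynomial set"
    unfolding restrict_scalars_simps
    by (rule Collect_cong, rule conj_cong[OF refl], rule diff_form_eq_zero_iff[OF that])
      (auto intro: forms_subset)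
  have "gradient_relation n J u" if "gradient_relation n I u" for u
    using that \<open>I \<subseteq> J\<close> unfolding gradient_relation_def by (meson subsetD)
  then have le: "{u \<in> carrier ?V. gradient_relation n I u} \<subseteq> {u \<in> carrier ?V. gradient_relation n J u}"
    by (auto simp del: form_tuples_simps)
  have "HF_Omega n I (Suc d) = HF_Omega n J (Suc d) \<longleftrightarrow>
      {u \<in> carrier ?V. gradient_relation n I u} = {u \<in> carrier ?V. gradient_relation n J u}"
    unfolding HF_Omega_def hilbert_kaehler_def hilbert_function_def
      kaehler_component_eq[OF I] kaehler_component_eq[OF J] ker[OF I, symmetric] ker[OF J, symmetric]
    by (intro dim_image_eq_iff_kernel_eq form_tuples_vectorspace form_tuples_fin_dim
        W diff_form_module_hom I J) (use le in \<open>simp only: ker[OF I] ker[OF J]\<close>)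
  with le show ?thesis by blast
qed


section \<open>The criterion for a single subscheme\<close>

lemma proj_subscheme_ideal: "proj_subscheme n I \<Longrightarrow> ideal I (poly_ring n)"
  by (simp add: proj_subscheme_def homogeneous_ideal_def)

lemma proj_subscheme_hom_component: "proj_subscheme n I \<Longrightarrow> f \<in> I \<Longrightarrow> hom_component d f \<in> I"
  by (simp add: proj_subscheme_def homogeneous_ideal_def)

text \<open>The polynomial witnessing a relation may be inhomogeneous. Its component of degree d + 1
  is still a witness, because I is homogeneous and differentiation shifts degrees by one. Hence only
  degrees d and d + 1 of the ideals matter.\<close>

lemma gradient_relation_form:
  assumes I: "proj_subscheme n I" and "gradient_relation n I u" and u: "\<And>k. k \<le> n \<Longrightarrow> u k \<in> forms n d"
  obtains f where "f \<in> I" "f \<in> forms n (Suc d)" "\<And>k. k \<le> n \<Longrightarrow> u k - partial_deriv k f \<in> I"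
proof -
  obtain f where "f \<in> I" and f: "\<And>k. k \<le> n \<Longrightarrow> u k - partial_deriv k f \<in> I"
    using assms(2) unfolding gradient_relation_def by blast
  show thesis
  proof (rule that)
    show "hom_component (Suc d) f \<in> I"
      using I \<open>f \<in> I\<close> by (rule proj_subscheme_hom_component)
    show "hom_component (Suc d) f \<in> forms n (Suc d)"
      using proj_subscheme_ideal[OF I] \<open>f \<in> I\<close> by (intro hom_component_in_forms ideal_subset)
    fix k assume "k \<le> n"
    then have "u k - partial_deriv k (hom_component (Suc d) f) = hom_component d (u k - partial_deriv k f)"
      by (simp add: hom_component_diff hom_component_partial_deriv hom_component_form[OF u])
    then show "u k - partial_deriv k (hom_component (Suc d) f) \<in> I"
      using proj_subscheme_hom_component[OF I f[OF \<open>k \<le> n\<close>]] by simp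
  qed
qed

text \<open>A relation for J involves a form of J in degree d + 1 and remainders in J of degree d.
  In both degrees the forms of J lie in I, so the same witness serves for I.\<close>

lemma HF_Omega_eq_of_HF_eq:
  assumes I: "proj_subscheme n I" and J: "proj_subscheme n J" and "I \<subseteq> J"
    and eq: "HF n I (Suc d) = HF n J (Suc d)"
  shows "HF_Omega n I (Suc d) = HF_Omega n J (Suc d)"
proof -
  note idI = proj_subscheme_ideal[OF I] and idJ = proj_subscheme_ideal[OF J]
  have top: "f \<in> I" if "f \<in> J" "f \<in> forms n (Suc d)" for f
    using HF_eq_iff[OF idI idJ \<open>I \<subseteq> J\<close>, of "Suc d"] eq that by auto
  have low: "f \<in> I" if f: "f \<in> J" "f \<in> forms n d" for f
  proof -
    have "g * f \<in> I" if "g \<in> forms n 1" for g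
    proof (rule top)
      show "g * f \<in> J" using idJ forms_subset[OF that] f(1) by (rule ideal_mult)
      show "g * f \<in> forms n (Suc d)" using forms_mult[OF that f(2)] by simp
    qed
    \<comment> \<open>Saturation is used with exponent 1: all products with linear forms lie in
      I.\<close>
    then show ?thesis
      using I forms_subset[OF f(2)] unfolding proj_subscheme_def saturated_def by blast
  qed
  have "gradient_relation n I u" if u: "u \<in> carrier (form_tuples n n d)" and "gradient_relation n J u" for u
  proof -
    have forms: "u k \<in> forms n d" if "k \<le> n" for k using u that by simp
    obtain f where f: "f \<in> J" "f \<in> forms n (Suc d)" "\<And>k. k \<le> n \<Longrightarrow> u k - partial_deriv k f \<in> J"
      by (rule gradient_relation_form[OF J \<open>gradient_relation n J u\<close>, of d]) (simp_all add: forms)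
    have "u k - partial_deriv k f \<in> I" if "k \<le> n" for k
      using low[OF f(3)[OF that]] forms_diff[OF forms[OF that] partial_deriv_in_forms[OF f(2)]] .
    then show ?thesis
      unfolding gradient_relation_def using top[OF f(1,2)] by (intro bexI[of _ f]) simp_all
  qed
  then show ?thesis
    unfolding HF_Omega_eq_iff[OF idI idJ \<open>I \<subseteq> J\<close>] by blast
qed

text \<open>
  The converse: the gradient of a form \<open>f \<in> J\<close> is a relation modulo \<open>J\<close>, hence modulo \<open>I\<close>,
  and contracting it with the Euler vector field returns a nonzero multiple of \<open>f\<close> modulo \<open>I\<close>.
\<close>

lemma HF_eq_of_HF_Omega_eq:
  fixes I J :: "'k::field polynomial set"
  assumes I: "proj_subscheme n I" and J: "proj_subscheme n J" and "I \<subseteq> J"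
    and eq: "HF_Omega n I (Suc d) = HF_Omega n J (Suc d)" and char: "of_nat (Suc d) \<noteq> (0::'k)"
  shows "HF n I (Suc d) = HF n J (Suc d)"
proof -
  note idI = proj_subscheme_ideal[OF I] and idJ = proj_subscheme_ideal[OF J]
  have "f \<in> I" if f: "f \<in> J" "f \<in> forms n (Suc d)" for f
  proof -
    let ?u = "\<lambda>k. if k \<le> n then partial_deriv k f else 0"
    have u: "?u \<in> carrier (form_tuples n n d)"
      using partial_deriv_in_forms[OF f(2)] by simp
    have "gradient_relation n J ?u"
      unfolding gradient_relation_def using f(1) ideal_zero[OF idJ] by (intro bexI[of _ f]) simp_all
    then have rel: "gradient_relation n I ?u"
      using eq u unfolding HF_Omega_eq_iff[OF idI idJ \<open>I \<subseteq> J\<close>] by blast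
    obtain g where g: "g \<in> I" "g \<in> forms n (Suc d)" "\<And>k. k \<le> n \<Longrightarrow> ?u k - partial_deriv k g \<in> I"
      by (rule gradient_relation_form[OF I rel, of d]) (simp_all add: partial_deriv_in_forms[OF f(2)])
    \<comment> \<open>A relation for I only says that the gradient of f agrees modulo I with that of
      some g in I. Euler's formula is therefore applied to f - g; since g is in I, this suffices for
      f.\<close>
    have "(\<Sum>k\<le>n. indet k * partial_deriv k (f - g)) \<in> I"
    proof (rule ideal_sum[OF idI])
      fix k assume "k \<in> {..n}"
      then have "k \<le> n" by simp
      with g(3)[OF this] show "indet k * partial_deriv k (f - g) \<in> I"
        by (intro ideal_mult[OF idI] forms_subset[OF indet_in_forms]) (simp_all add: partial_deriv_diff)
    qed
    then have "of_nat (Suc d) * (f - g) \<in> I"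
      using euler_formula[OF forms_diff[OF f(2) g(2)]] by simp
    \<comment> \<open>Division by d + 1 is multiplication with a constant polynomial, under which I
      is closed.\<close>
    then have "Poly_Mapping.single 0 (inverse (of_nat (Suc d))) * (of_nat (Suc d) * (f - g)) \<in> I"
      by (rule ideal_mult[OF idI poly_ring_consts(3)])
    also have "Poly_Mapping.single 0 (inverse (of_nat (Suc d))) * (of_nat (Suc d) * (f - g)) = f - g"
    proof -
      have "Poly_Mapping.single 0 (inverse (of_nat (Suc d))) * of_nat (Suc d) = (1 :: 'k polynomial)"
        using char unfolding single_of_nat[symmetric] mult_single by simp
      then show ?thesis by (simp add: mult.assoc[symmetric] del: of_nat_Suc)
    qed
    finally show "f \<in> I"
      using ideal_add[OF idI _ g(1), of "f - g"] by simp
  qed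
  then have "I \<inter> forms n (Suc d) = J \<inter> forms n (Suc d)"
    using \<open>I \<subseteq> J\<close> by blast
  then show ?thesis
    using HF_eq_iff[OF idI idJ \<open>I \<subseteq> J\<close>] by simp
qed

theorem corollary8p7:
  fixes n i j :: nat and I :: "'k::field polynomial set"
  assumes "perfect_field TYPE('k)"
    and "n \<ge> 1"
    and "proj_subscheme n I"
    and "zero_dimensional n I"
    and "rational_support n I"
    and "\<forall>p\<in>support_points n I. indet 0 \<notin> p"
    and "1 \<le> i" and "i < scheme_degree n I"
    and "1 \<le> j" and "j \<le> regularity_index n I - 1"
    and "CHAR('k) = 0 \<or> CHAR('k) > regularity_index n I"
  shows "uniform_scheme n I i j \<longleftrightarrow>
    (\<forall>J. subscheme_of n J I \<and> scheme_degree n J = scheme_degree n I - i \<longrightarrow>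
         HF_Omega n I j = HF_Omega n J j)"
proof -
  obtain d where d: "j = Suc d" using assms(9) by (cases j) simp_all
  \<comment> \<open>In characteristic 0 divisibility would mean j = 0. Otherwise j is positive and
    at most \<open>regularity_index n I - 1\<close>, hence smaller than the characteristic.\<close>
  have "\<not> CHAR('k) dvd j"
    using assms(9,10,11) by (auto dest: dvd_imp_le)
  then have char: "of_nat (Suc d) \<noteq> (0::'k)"
    unfolding d[symmetric] of_nat_eq_0_iff_char_dvd .
  \<comment> \<open>The degree of the subscheme only selects which J are considered on either side;
    the equivalence is proved for an arbitrary subscheme.\<close>
  have "HF n J j = HF n I j \<longleftrightarrow> HF_Omega n I j = HF_Omega n J j" if "subscheme_of n J I" for J
    using HF_Omega_eq_of_HF_eq[OF assms(3), of J d] HF_eq_of_HF_Omega_eq[OF assms(3), of J d] char that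
    unfolding d subscheme_of_def by metis
  then show ?thesis
    unfolding uniform_scheme_def by blast
qed

end
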